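(* For every $c_0>0$ there is a constant $C$ depending only on $c_0$ such that the following holds. Let $N\ge 2$ be an integer and let $\Sigma\subset S^2$ be a collection of $N$ unit vectors such that $$\|\mathbf{v}-\mathbf{v}'\|\ge c_0 N^{-1/2}\quad\text{for all }\mathbf{v}\ne\mathbf{v}'\in\Sigma.$$ Then for each $F\in L^2(\mathbb{R}^3)$, $$\|M_0^\Sigma F\|_{L^2(\mathbb{R}^3)}\le C\, N^{1/4}\sqrt{\log N}\,\|F\|_{L^2(\mathbb{R}^3)}.$$
   Context: $S^2$ is the unit sphere in $\mathbb{R}^3$. For a finite set $\Sigma\subset S^2$ and $F:\mathbb{R}^3\to\mathbb{R}$, the maximal operator of averages at scale $1$ along the directions in $\Sigma$ is $$M_0^\Sigma F(\mathbf{x})=\max_{\mathbf{v}\in\Sigma}\left|\int_{-1/2}^{1/2}F(\mathbf{x}+t\mathbf{v})\,dt\right|,$$ defined for almost every $\mathbf{x}\in\mathbb{R}^3$. *)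

theory Defs
  imports "HOL-Analysis.Analysis"
begin

definition in_L2 :: "('a::euclidean_space \<Rightarrow> real) \<Rightarrow> bool" where
  "in_L2 f \<longleftrightarrow> f \<in> borel_measurable lebesgue \<and> integrable lebesgue (\<lambda>x. (f x)\<^sup>2)"

text \<open>Meaningful only under \<open>in_L2 f\<close>: the Bochner integral of a non-integrable function is \<open>0\<close>.\<close>

definition norm_L2 :: "('a::euclidean_space \<Rightarrow> real) \<Rightarrow> real" where
  "norm_L2 f = sqrt (LINT x|lebesgue. (f x)\<^sup>2)"

text \<open>
  For \<open>F\<close> in \<open>L\<^sup>2\<close> and a fixed unit vector \<open>v\<close>, Fubini's theorem shows that
  \<open>t \<mapsto> F (x + t v)\<close> is Lebesgue integrable on \<open>[-1/2, 1/2]\<close> for almost every \<open>x\<close>. On the remaining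
  null set the integral takes the default value \<open>0\<close>, which affects neither the measurability
  nor the \<open>L\<^sup>2\<close> norm of the maximal function.
\<close>

definition unit_average :: "'a::euclidean_space \<Rightarrow> ('a \<Rightarrow> real) \<Rightarrow> 'a \<Rightarrow> real" where
  "unit_average v F x = (LINT t:{-1/2..1/2}|lebesgue. F (x + t *\<^sub>R v))"

text \<open>Intended for finite nonempty \<open>V\<close>, where \<open>Max\<close> is the actual maximum.\<close>

definition maximal_average :: "'a::euclidean_space set \<Rightarrow> ('a \<Rightarrow> real) \<Rightarrow> 'a \<Rightarrow> real" where
  "maximal_average V F x = Max ((\<lambda>v. \<bar>unit_average v F x\<bar>) ` V)"

end

theory Submission
  imports Defs "HOL-Probability.Characteristic_Functions"
begin

text \<open>
  Chaining over the scales \<open>d = 4 / 2 ^ i\<close>: approximate \<open>V\<close> by coarser and coarser separated subsets,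
  down to a single direction. If \<open>D\<close> is \<open>d\<close>-separated and \<open>\<pi>\<close> moves the points of \<open>D\<close> by at most \<open>2 d\<close>,
  then by Plancherel the square function of the differences \<open>unit_average u F - unit_average (\<pi> u) F\<close>
  has squared norm at most \<open>sup\<^sub>\<xi> (\<Sum>u\<in>D. \<bar>m (\<xi> \<bullet> u) - m (\<xi> \<bullet> \<pi> u)\<bar>\<^sup>2)\<close> times that of \<open>F\<close>, where
  \<open>m s = sin (s/2) / (s/2)\<close>. As a strip of half-width \<open>h\<close> around a great circle contains at most
  \<open>O((1 + h/d) / d)\<close> points of \<open>D\<close>, this supremum is \<open>O(1/d)\<close>. Summing over the \<open>O(log N)\<close> scales down
  to \<open>d = N powr (-1/2)\<close>, with one use of Cauchy-Schwarz, gives \<open>N powr (1/2) * log N\<close> for the squared norm.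

  Plancherel is only needed for bounded continuous integrable functions, where it follows from Fubini
  and Gaussian summation. A general \<open>F\<close> in \<open>L\<^sup>2\<close> is then dominated everywhere by a lower semicontinuous
  function of comparable norm, an increasing limit of such functions.
\<close>

section \<open>Separated points near a great circle\<close>

text \<open>The obstacle is low frequency. There every multiplier
  \<open>segment_mult (\<xi> \<bullet> u)\<close> is close to 1, so the sum of squares over a single
  separated set \<open>D\<close> is as large as its cardinality, possibly of order
  \<open>1/d^2\<close>; this would only give norm \<open>N powr (1/2)\<close>. Differences between
  neighbouring directions vanish at low frequency and so repair it. If \<open>norm \<xi> * d\<close>
  is at least 1, the decay of the multiplier leaves a strip of width comparable to \<open>d\<close>
  around the great circle orthogonal to \<open>\<xi>\<close>, with O(1/d) points. If it is smaller,
  the relevant strip has width \<open>1 / norm \<xi>\<close> and up to O(1/(norm \<xi> * d^2))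
  points, but the cancellation contributes a factor \<open>(norm \<xi> * d)^2\<close>, and the
  product is again O(1/d).

  The scales start at 4 because the sphere has diameter 2: a 4-separated set of directions has at
  most one element. The passage to general \<open>F\<close> goes through domination at every point,
  so that no limit of signed averages is ever taken and exceptional null sets matter only for
  measurability. The numerical constants are generous roundings.\<close>

lemma card_floor_interval_le:
  fixes a :: real
  assumes "a \<ge> 0"
  shows "real (card {\<lfloor>- a\<rfloor>..\<lfloor>a\<rfloor>}) \<le> 2 * a + 2"
proof -
  have "\<lfloor>- a\<rfloor> \<le> \<lfloor>a\<rfloor>" using assms by (intro floor_mono) simp
  then have "real (card {\<lfloor>- a\<rfloor>..\<lfloor>a\<rfloor>}) = \<lfloor>a\<rfloor> - \<lfloor>- a\<rfloor> + 1"
    by simp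
  also have "\<dots> \<le> 2 * a + 2" by linarith
  finally show ?thesis .
qed

lemma floor_divide_eq_imp_abs_diff_less:
  fixes x y e :: real
  assumes "e > 0" "\<lfloor>x / e\<rfloor> = \<lfloor>y / e\<rfloor>"
  shows "\<bar>x - y\<bar> < e"
proof -
  have "\<bar>x / e - y / e\<bar> < 1" using assms(2) by linarith
  then have "\<bar>(x - y) / e\<bar> < 1" by (simp add: diff_divide_distrib)
  then show ?thesis using assms(1) by (simp add: abs_divide)
qed

text \<open>Where \<open>\<bar>r\<bar> \<ge> 1/2\<close>, the sign of \<open>r\<close> and the coordinates \<open>p\<close>, \<open>q\<close> determine \<open>r\<close> in a Lipschitz way,
  so the cells of a planar grid contain at most two points each.\<close>

lemma card_separated_graph_le:
  fixes p q r :: "'a \<Rightarrow> real"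
  assumes fin: "finite X" and d: "d > 0"
    and sphere: "\<And>x. x \<in> X \<Longrightarrow> (p x)\<^sup>2 + (q x)\<^sup>2 + (r x)\<^sup>2 = 1"
    and sep: "\<And>x y. x \<in> X \<Longrightarrow> y \<in> X \<Longrightarrow> x \<noteq> y \<Longrightarrow>
      (p x - p y)\<^sup>2 + (q x - q y)\<^sup>2 + (r x - r y)\<^sup>2 \<ge> d\<^sup>2"
    and r: "\<And>x. x \<in> X \<Longrightarrow> \<bar>r x\<bar> \<ge> 1/2"
    and a: "\<And>x. x \<in> X \<Longrightarrow> \<bar>p x\<bar> \<le> a" "a \<ge> 0"
    and b: "\<And>x. x \<in> X \<Longrightarrow> \<bar>q x\<bar> \<le> b" "b \<ge> 0"
  shows "real (card X) \<le> 2 * (10 * a / d + 2) * (10 * b / d + 2)"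
proof -
  \<comment> \<open>Two points of one cell turn out to differ by at most \<open>e\<close>,
    \<open>e\<close> and \<open>4 * e\<close> in the three coordinates, so their squared distance is
    at most \<open>18 * e^2\<close>. With \<open>e = d / 5\<close> this is below \<open>d^2\<close>,
    because 18 < 25.\<close>
  define e where "e = d / 5"
  have e: "e > 0" using d by (simp add: e_def)
  define g where "g = (\<lambda>x. (\<lfloor>p x / e\<rfloor>, \<lfloor>q x / e\<rfloor>, r x > 0))"
  have le1: "\<bar>p x\<bar> \<le> 1" "\<bar>q x\<bar> \<le> 1" if "x \<in> X" for x
  proof -
    have "(p x)\<^sup>2 \<le> 1" "(q x)\<^sup>2 \<le> 1"
      using sphere[OF that] zero_le_power2[of "p x"] zero_le_power2[of "q x"] zero_le_power2[of "r x"]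
      by linarith+
    then show "\<bar>p x\<bar> \<le> 1" "\<bar>q x\<bar> \<le> 1" by (simp_all add: abs_square_le_1)
  qed
  have inj: "inj_on g X"
  proof (rule inj_onI, rule ccontr)
    fix x y assume xy: "x \<in> X" "y \<in> X" "g x = g y" "x \<noteq> y"
    have p: "\<bar>p x - p y\<bar> < e" and q: "\<bar>q x - q y\<bar> < e"
      using xy e by (auto simp: g_def intro: floor_divide_eq_imp_abs_diff_less)
    have sum: "\<bar>r x + r y\<bar> \<ge> 1"
      using r[of x] r[of y] xy by (auto simp: g_def abs_if split: if_splits)
    \<comment> \<open>The two sphere equations are subtracted. Since \<open>r x + r y\<close> has
      absolute value at least 1, the difference in \<open>r\<close> is controlled by those in
      \<open>p\<close> and \<open>q\<close>; the coordinates are at most 1 in absolute value, whence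
      the factor 4.\<close>
    have "(r x - r y) * (r x + r y) = (p y - p x) * (p x + p y) + (q y - q x) * (q x + q y)"
      using sphere[of x] sphere[of y] xy by (simp add: algebra_simps power2_eq_square)
    then have "\<bar>r x - r y\<bar> * \<bar>r x + r y\<bar> = \<bar>(p y - p x) * (p x + p y) + (q y - q x) * (q x + q y)\<bar>"
      by (metis abs_mult)
    also have "\<dots> \<le> \<bar>p x - p y\<bar> * \<bar>p x + p y\<bar> + \<bar>q x - q y\<bar> * \<bar>q x + q y\<bar>"
      by (metis abs_minus_commute abs_mult abs_triangle_ineq)
    also have "\<dots> \<le> e * 2 + e * 2"
      using p q le1[of x] le1[of y] xy e by (intro add_mono mult_mono) auto
    finally have "\<bar>r x - r y\<bar> * \<bar>r x + r y\<bar> \<le> 4 * e" by simp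
    moreover have "\<bar>r x - r y\<bar> * 1 \<le> \<bar>r x - r y\<bar> * \<bar>r x + r y\<bar>"
      using sum by (intro mult_left_mono) auto
    ultimately have rr: "\<bar>r x - r y\<bar> \<le> 4 * e" by simp
    have "\<bar>p x - p y\<bar> \<le> \<bar>e\<bar>" "\<bar>q x - q y\<bar> \<le> \<bar>e\<bar>" "\<bar>r x - r y\<bar> \<le> \<bar>4 * e\<bar>"
      using p q rr e by auto
    then have "(p x - p y)\<^sup>2 \<le> e\<^sup>2" "(q x - q y)\<^sup>2 \<le> e\<^sup>2" "(r x - r y)\<^sup>2 \<le> (4 * e)\<^sup>2"
      by (simp_all only: abs_le_square_iff)
    then have "(p x - p y)\<^sup>2 + (q x - q y)\<^sup>2 + (r x - r y)\<^sup>2 \<le> 18 * e\<^sup>2"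
      by (simp add: power_mult_distrib)
    also have "\<dots> < d\<^sup>2" using d by (simp add: e_def power_divide)
    finally show False using sep[OF xy(1,2,4)] by simp
  qed
  have "g ` X \<subseteq> {\<lfloor>- (a / e)\<rfloor>..\<lfloor>a / e\<rfloor>} \<times> {\<lfloor>- (b / e)\<rfloor>..\<lfloor>b / e\<rfloor>} \<times> UNIV"
  proof -
    have "- (a / e) \<le> p x / e" "p x / e \<le> a / e" "- (b / e) \<le> q x / e" "q x / e \<le> b / e"
      if "x \<in> X" for x
      using a(1)[OF that] b(1)[OF that] e divide_right_mono[of "- a" "p x" e]
        divide_right_mono[of "p x" a e] divide_right_mono[of "- b" "q x" e] divide_right_mono[of "q x" b e]
      by (simp_all add: abs_le_iff)
    then show ?thesis by (auto simp: g_def intro!: floor_mono)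
  qed
  then have "card (g ` X) \<le> card ({\<lfloor>- (a / e)\<rfloor>..\<lfloor>a / e\<rfloor>} \<times> {\<lfloor>- (b / e)\<rfloor>..\<lfloor>b / e\<rfloor>} \<times> (UNIV :: bool set))"
    by (intro card_mono) auto
  then have "card X \<le> card {\<lfloor>- (a / e)\<rfloor>..\<lfloor>a / e\<rfloor>} * (card {\<lfloor>- (b / e)\<rfloor>..\<lfloor>b / e\<rfloor>} * 2)"
    by (simp only: card_image[OF inj] card_cartesian_product card_UNIV_bool)
  then have "real (card X) \<le> real (card {\<lfloor>- (a / e)\<rfloor>..\<lfloor>a / e\<rfloor>} * (card {\<lfloor>- (b / e)\<rfloor>..\<lfloor>b / e\<rfloor>} * 2))"
    by (rule of_nat_mono)
  also have "\<dots> = real (card {\<lfloor>- (a / e)\<rfloor>..\<lfloor>a / e\<rfloor>}) * (real (card {\<lfloor>- (b / e)\<rfloor>..\<lfloor>b / e\<rfloor>}) * 2)"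
    by (simp only: of_nat_mult of_nat_numeral)
  also have "\<dots> \<le> (2 * (a / e) + 2) * ((2 * (b / e) + 2) * 2)"
    using a b e by (intro mult_mono card_floor_interval_le mult_right_mono) auto
  also have "\<dots> = 2 * (10 * a / d + 2) * (10 * b / d + 2)" by (simp add: e_def algebra_simps)
  finally show ?thesis .
qed

definition separated :: "real \<Rightarrow> 'a::metric_space set \<Rightarrow> bool" where
  "separated d V \<longleftrightarrow> (\<forall>v\<in>V. \<forall>w\<in>V. v \<noteq> w \<longrightarrow> dist v w \<ge> d)"

text \<open>Rotate \<open>e\<close> to the first axis. A unit vector has some coordinate of absolute
  value at least 1/2, as otherwise its squared norm is at most 3/4, so three graph charts cover the
  strip. In the two charts that keep \<open>p\<close> as a parameter, \<open>p\<close> ranges over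
  an interval of half-length \<open>h\<close> and the other parameter over one of half-length 1;
  this gives the product \<open>(1 + h/d) * (1/d)\<close>.\<close>

lemma card_separated_strip_le:
  fixes D :: "(real^3) set"
  assumes fin: "finite D" and D: "D \<subseteq> sphere 0 1" "separated d D" and d: "0 < d" "d \<le> 2"
    and e: "norm e = 1" and h: "h \<ge> 0"
  shows "real (card {v\<in>D. \<bar>v \<bullet> e\<bar> \<le> h}) \<le> 1400 * (1 + h / d) / d"
proof -
  obtain f :: "real^3 \<Rightarrow> real^3" where f: "orthogonal_transformation f" "f e = axis 1 1"
    using orthogonal_transformation_exists_1[OF e, of "axis 1 1"] by auto
  define p q r where "p = (\<lambda>v. f v $ 1)" and "q = (\<lambda>v. f v $ 2)" and "r = (\<lambda>v. f v $ 3)"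
  have lin: "linear f" using f(1) by (simp add: orthogonal_transformation_def)
  have normf: "(p v)\<^sup>2 + (q v)\<^sup>2 + (r v)\<^sup>2 = (norm v)\<^sup>2" for v
  proof -
    have "(norm v)\<^sup>2 = f v \<bullet> f v"
      using f(1) by (simp add: orthogonal_transformation_def power2_norm_eq_inner)
    then show ?thesis by (simp add: inner_vec_def sum_3 p_def q_def r_def power2_eq_square)
  qed
  have pe: "p v = v \<bullet> e" for v
    using f by (metis orthogonal_transformation_def p_def inner_axis inner_real_def mult.right_neutral)
  have sphere: "(p v)\<^sup>2 + (q v)\<^sup>2 + (r v)\<^sup>2 = 1" if "v \<in> D" for v
    using normf[of v] D(1) that by (auto simp: sphere_def)
  have sep: "(p v - p w)\<^sup>2 + (q v - q w)\<^sup>2 + (r v - r w)\<^sup>2 \<ge> d\<^sup>2" if "v \<in> D" "w \<in> D" "v \<noteq> w" for v w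
  proof -
    have "(p v - p w)\<^sup>2 + (q v - q w)\<^sup>2 + (r v - r w)\<^sup>2 = (norm (v - w))\<^sup>2"
      using normf[of "v - w"] by (simp add: p_def q_def r_def linear_diff[OF lin])
    moreover have "norm (v - w) \<ge> d" using D(2) that by (auto simp: separated_def dist_norm)
    ultimately show ?thesis using d(1) by (simp add: power_mono)
  qed
  have le1: "\<bar>p x\<bar> \<le> 1" "\<bar>q x\<bar> \<le> 1" "\<bar>r x\<bar> \<le> 1" if "x \<in> D" for x
  proof -
    have "(p x)\<^sup>2 \<le> 1" "(q x)\<^sup>2 \<le> 1" "(r x)\<^sup>2 \<le> 1"
      using sphere[OF that] zero_le_power2[of "p x"] zero_le_power2[of "q x"] zero_le_power2[of "r x"]
      by linarith+
    then show "\<bar>p x\<bar> \<le> 1" "\<bar>q x\<bar> \<le> 1" "\<bar>r x\<bar> \<le> 1" by (simp_all add: abs_square_le_1)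
  qed
  define S where "S = {v\<in>D. \<bar>v \<bullet> e\<bar> \<le> h}"
  define A B E where "A = {v\<in>S. \<bar>p v\<bar> \<ge> 1/2}" and "B = {v\<in>S. \<bar>q v\<bar> \<ge> 1/2}"
    and "E = {v\<in>S. \<bar>r v\<bar> \<ge> 1/2}"
  have finS: "finite S" "finite A" "finite B" "finite E"
    using fin by (auto simp: S_def A_def B_def E_def)
  have SD: "S \<subseteq> D" "A \<subseteq> D" "B \<subseteq> D" "E \<subseteq> D" by (auto simp: S_def A_def B_def E_def)
  have ph: "\<bar>p v\<bar> \<le> h" if "v \<in> S" for v using that by (simp add: S_def pe)
  have "S \<subseteq> A \<union> B \<union> E"
  proof (rule subsetI, rule ccontr)
    fix v assume v: "v \<in> S" "v \<notin> A \<union> B \<union> E"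
    then have "\<bar>p v\<bar> < 1/2" "\<bar>q v\<bar> < 1/2" "\<bar>r v\<bar> < 1/2" by (auto simp: A_def B_def E_def)
    then have "(p v)\<^sup>2 \<le> (1/2)\<^sup>2" "(q v)\<^sup>2 \<le> (1/2)\<^sup>2" "(r v)\<^sup>2 \<le> (1/2)\<^sup>2"
      by (auto intro!: power2_le_iff_abs_le[THEN iffD2])
    then have "(p v)\<^sup>2 + (q v)\<^sup>2 + (r v)\<^sup>2 \<le> 3/4" by (simp add: power2_eq_square)
    then show False using sphere[of v] v SD by auto
  qed
  then have "card S \<le> card (A \<union> B \<union> E)" using finS by (intro card_mono) auto
  also have "\<dots> \<le> card A + card B + card E"
    by (meson add_le_mono1 card_Un_le le_trans)
  finally have card: "real (card S) \<le> real (card A) + real (card B) + real (card E)" by simp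
  have ten: "10 * 1 / d + 2 \<le> 14 / d" using d by (simp add: field_simps)
  have cE: "real (card E) \<le> 2 * (10 * h / d + 2) * (10 * 1 / d + 2)"
  proof (rule card_separated_graph_le[where p=p and q=q and r=r])
    fix x y assume xy: "x \<in> E" "y \<in> E" "x \<noteq> y"
    then show "d\<^sup>2 \<le> (p x - p y)\<^sup>2 + (q x - q y)\<^sup>2 + (r x - r y)\<^sup>2" using sep[of x y] SD by auto
  qed (use finS SD d h sphere ph le1 in \<open>auto simp: E_def S_def\<close>)
  have cB: "real (card B) \<le> 2 * (10 * h / d + 2) * (10 * 1 / d + 2)"
  proof (rule card_separated_graph_le[where p=p and q=r and r=q])
    fix x y assume xy: "x \<in> B" "y \<in> B" "x \<noteq> y"
    then show "d\<^sup>2 \<le> (p x - p y)\<^sup>2 + (r x - r y)\<^sup>2 + (q x - q y)\<^sup>2" using sep[of x y] SD by (auto simp: ac_simps)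
  next
    fix x assume "x \<in> B" then show "(p x)\<^sup>2 + (r x)\<^sup>2 + (q x)\<^sup>2 = 1" using sphere[of x] SD by (auto simp: ac_simps)
  qed (use finS SD d h ph le1 in \<open>auto simp: B_def S_def\<close>)
  have cA0: "real (card A) \<le> 2 * (10 * 1 / d + 2) * (10 * 1 / d + 2)"
  proof (rule card_separated_graph_le[where p=q and q=r and r=p])
    fix x y assume xy: "x \<in> A" "y \<in> A" "x \<noteq> y"
    then show "d\<^sup>2 \<le> (q x - q y)\<^sup>2 + (r x - r y)\<^sup>2 + (p x - p y)\<^sup>2" using sep[of x y] SD by (auto simp: ac_simps)
  next
    fix x assume "x \<in> A" then show "(q x)\<^sup>2 + (r x)\<^sup>2 + (p x)\<^sup>2 = 1" using sphere[of x] SD by (auto simp: ac_simps)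
  qed (use finS SD d h le1 in \<open>auto simp: A_def S_def\<close>)
  \<comment> \<open>The chart solved for \<open>p\<close> only sees the crude count of order
    \<open>1/d^2\<close>. It is nonempty only if \<open>h \<ge> 1/2\<close>, and then
    \<open>1 \<le> 2 * h\<close> supplies the missing factor: 784 is twice
    \<open>2 * 14 * 14\<close>.\<close>
  have cA: "real (card A) \<le> 784 * (h / d) / d"
  proof (cases "A = {}")
    case False
    then obtain v where "v \<in> S" "\<bar>p v\<bar> \<ge> 1/2" by (auto simp: A_def)
    with ph[of v] have h2: "h \<ge> 1/2" by simp
    have "2 * (10 * 1 / d + 2) * (10 * 1 / d + 2) \<le> 2 * (14 / d) * (14 / d)"
      using ten d by (intro mult_mono) auto
    also have "\<dots> = 784 * (1/2) / d / d" by simp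
    also have "\<dots> \<le> 784 * h / d / d"
      using h2 d by (intro divide_right_mono mult_left_mono) auto
    finally show ?thesis using cA0 by simp
  qed (use h d in simp)
  have "2 * (10 * h / d + 2) * (10 * 1 / d + 2) \<le> 2 * (10 * h / d + 10) * (14 / d)"
    using ten d h by (intro mult_mono) auto
  also have "\<dots> = 280 * (1 + h / d) / d" by (simp add: algebra_simps add_divide_distrib)
  finally have "real (card S) \<le> 784 * (h / d) / d + 2 * (280 * (1 + h / d) / d)"
    using cA cB cE card by linarith
  also have "\<dots> \<le> 1400 * (1 + h / d) / d"
  proof -
    have "784 * k + 2 * (280 * (1 + k)) \<le> 1400 * (1 + k)" if "k \<ge> 0" for k :: real
      using that by simp
    from this[of "h / d"] have "784 * (h / d) + 2 * (280 * (1 + h / d)) \<le> 1400 * (1 + h / d)"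
      using h d by simp
    then have "(784 * (h / d) + 2 * (280 * (1 + h / d))) / d \<le> 1400 * (1 + h / d) / d"
      using d by (intro divide_right_mono) auto
    then show ?thesis by (simp add: add_divide_distrib)
  qed
  finally show ?thesis by (simp add: S_def)
qed

section \<open>The Fourier multiplier of the unit average\<close>

text \<open>This is the function \<open>m\<close> of the overview. In integral form the bound by 1
  and the Lipschitz bound come from the integrand, and \<open>s = 0\<close> needs no separate
  treatment as it would for a quotient.\<close>

definition segment_mult :: "real \<Rightarrow> complex" where
  "segment_mult s = (LINT t:{-1/2..1/2}|lborel. cis (t * s))"

lemma norm_cis_diff_le: "cmod (cis a - cis b) \<le> \<bar>a - b\<bar>"
proof -
  have "(cmod (cis a - cis b))\<^sup>2 = (cos a - cos b)\<^sup>2 + (sin a - sin b)\<^sup>2"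
    by (simp add: cmod_power2)
  also have "\<dots> = ((sin a)\<^sup>2 + (cos a)\<^sup>2) + ((sin b)\<^sup>2 + (cos b)\<^sup>2) - 2 * cos (a - b)"
    unfolding cos_diff by (simp add: power2_eq_square algebra_simps)
  also have "\<dots> = 2 - 2 * cos (2 * ((a - b) / 2))" by (simp only: sin_cos_squared_add nonzero_mult_div_cancel_left times_divide_eq_right)
  also have "\<dots> = (2 * sin ((a - b) / 2))\<^sup>2"
    unfolding cos_double_sin[of "(a - b) / 2"] by (simp add: power_mult_distrib)
  finally have "cmod (cis a - cis b) = \<bar>2 * sin ((a - b) / 2)\<bar>"
    by (metis norm_ge_zero real_sqrt_abs real_sqrt_unique)
  also have "\<dots> \<le> \<bar>a - b\<bar>"
    using abs_sin_x_le_abs_x[of "(a - b) / 2"] by (simp add: abs_mult)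
  finally show ?thesis .
qed

lemma set_integrable_segment_cis: "set_integrable lborel {-1/2..1/2} (\<lambda>t. cis (t * s))"
  unfolding set_integrable_def
  by (intro borel_integrable_compact continuous_intros) auto

text \<open>The factor \<open>s\<close> on the left keeps the closed form valid at
  \<open>s = 0\<close>. The right-hand side is bounded by 2 and is 1-Lipschitz in \<open>s\<close>;
  these two facts yield all the decay estimates below.\<close>

lemma segment_mult_eq: "s *\<^sub>R segment_mult s = - \<i> * (cis (s / 2) - cis (- s / 2))"
proof (cases "s = 0")
  case False
  have "segment_mult s = - \<i> / s * cis (1/2 * s) - (- \<i> / s * cis (-1/2 * s))"
    unfolding segment_mult_def set_lebesgue_integral_def
  proof (rule integral_FTC_Icc)
    fix x :: real
    have "((\<lambda>t. - \<i> / s * exp (t *\<^sub>R (\<i> * s))) has_vector_derivative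
        - \<i> / s * (exp (x *\<^sub>R (\<i> * s)) * (\<i> * s))) (at x within {-1/2..1/2})"
      by (intro has_vector_derivative_mult_right exp_scaleR_has_vector_derivative_right)
    then show "((\<lambda>t. - \<i> / s * cis (t * s)) has_vector_derivative cis (x * s)) (at x within {-1/2..1/2})"
      using False by (simp add: cis_conv_exp scaleR_conv_of_real mult_ac)
  qed (auto intro!: continuous_intros)
  then show ?thesis using False by (simp add: scaleR_conv_of_real field_simps)
qed simp

lemma norm_segment_mult_diff_le: "cmod (segment_mult a - segment_mult b) \<le> \<bar>a - b\<bar>"
proof -
  have "segment_mult a - segment_mult b = (LINT t:{-1/2..1/2}|lborel. cis (t * a) - cis (t * b))"
    unfolding segment_mult_def
    by (intro set_integral_diff(2)[symmetric] set_integrable_segment_cis)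
  also have "cmod \<dots> \<le> (LINT t:{-1/2..1/2::real}|lborel. \<bar>a - b\<bar>)"
    unfolding set_lebesgue_integral_def
  proof (rule Bochner_Integration.integral_norm_bound_integral)
    show "integrable lborel (\<lambda>t. indicator {-1/2..1/2} t *\<^sub>R (cis (t * a) - cis (t * b)))"
      using set_integral_diff(1)[OF set_integrable_segment_cis set_integrable_segment_cis]
      by (simp add: set_integrable_def)
    show "integrable lborel (\<lambda>t::real. indicator {-1/2..1/2} t *\<^sub>R \<bar>a - b\<bar>)"
      by (intro borel_integrable_compact continuous_intros) auto
    fix t :: real
    show "cmod (indicator {-1/2..1/2} t *\<^sub>R (cis (t * a) - cis (t * b))) \<le> indicator {-1/2..1/2} t *\<^sub>R \<bar>a - b\<bar>"
    proof (cases "t \<in> {-1/2..1/2}")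
      case True
      have "cmod (cis (t * a) - cis (t * b)) \<le> \<bar>t\<bar> * \<bar>a - b\<bar>"
        using norm_cis_diff_le[of "t * a" "t * b"] by (simp add: abs_mult flip: right_diff_distrib)
      also have "\<dots> \<le> 1 * \<bar>a - b\<bar>" using True by (intro mult_right_mono) auto
      finally show ?thesis using True by simp
    qed simp
  qed
  also have "\<dots> = \<bar>a - b\<bar>" by (simp add: set_lebesgue_integral_def)
  finally show ?thesis .
qed

lemma norm_segment_mult_le_1: "cmod (segment_mult s) \<le> 1"
proof -
  have "cmod (segment_mult s) \<le> (LINT t:{-1/2..1/2::real}|lborel. 1)"
    unfolding segment_mult_def set_lebesgue_integral_def
    using set_integrable_segment_cis[unfolded set_integrable_def]
    by (rule Bochner_Integration.integral_norm_bound_integral)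
      (auto intro!: borel_integrable_compact continuous_intros simp del: indicator_simps split: split_indicator)
  then show ?thesis by (simp add: set_lebesgue_integral_def)
qed

lemma norm_segment_mult_le_inverse: "\<bar>s\<bar> * cmod (segment_mult s) \<le> 2"
proof -
  have "\<bar>s\<bar> * cmod (segment_mult s) = cmod (cis (s / 2) - cis (- s / 2))"
    using arg_cong[OF segment_mult_eq[of s], of cmod] by (simp add: norm_mult)
  also have "\<dots> \<le> 2" using norm_triangle_ineq4[of "cis (s / 2)" "cis (- s / 2)"] by simp
  finally show ?thesis .
qed

text \<open>Decay and cancellation are gained simultaneously. With
  \<open>n s = s * segment_mult s\<close>, the product
  \<open>a * (segment_mult a - segment_mult b)\<close> equals
  \<open>(n a - n b) - (a - b) * segment_mult b\<close>, and each of the two terms is at most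
  \<open>\<bar>a - b\<bar>\<close>.\<close>

lemma norm_segment_mult_diff_le_divide:
  "\<bar>a\<bar> * cmod (segment_mult a - segment_mult b) \<le> 2 * \<bar>a - b\<bar>"
proof -
  let ?n = "\<lambda>s. - \<i> * (cis (s / 2) - cis (- s / 2))"
  have "?n a - ?n b = - \<i> * ((cis (a / 2) - cis (b / 2)) - (cis (- a / 2) - cis (- b / 2)))"
    by (simp only: right_diff_distrib diff_diff_eq2 diff_diff_add add_ac) (simp add: algebra_simps)
  then have "cmod (?n a - ?n b) = cmod ((cis (a / 2) - cis (b / 2)) - (cis (- a / 2) - cis (- b / 2)))"
    by (simp only: norm_mult norm_minus_cancel norm_ii mult_1)
  also have "\<dots> \<le> \<bar>a / 2 - b / 2\<bar> + \<bar>- a / 2 - - b / 2\<bar>"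
    by (intro order_trans[OF norm_triangle_ineq4] add_mono norm_cis_diff_le)
  also have "\<dots> = \<bar>a - b\<bar>" by simp
  finally have n: "cmod (?n a - ?n b) \<le> \<bar>a - b\<bar>" .
  have "a *\<^sub>R (segment_mult a - segment_mult b) = (?n a - ?n b) - (a - b) *\<^sub>R segment_mult b"
    unfolding segment_mult_eq[symmetric] by (simp add: algebra_simps)
  then have "\<bar>a\<bar> * cmod (segment_mult a - segment_mult b)
      = cmod ((?n a - ?n b) - (a - b) *\<^sub>R segment_mult b)"
    by (metis norm_scaleR)
  also have "\<dots> \<le> cmod (?n a - ?n b) + \<bar>a - b\<bar> * cmod (segment_mult b)"
    by (metis norm_scaleR norm_triangle_ineq4)
  also have "\<dots> \<le> \<bar>a - b\<bar> + \<bar>a - b\<bar> * 1"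
    by (intro add_mono n mult_left_mono norm_segment_mult_le_1) auto
  finally show ?thesis by simp
qed

text \<open>Dyadic layers: where \<open>s\<close> is comparable to \<open>2 ^ k\<close>, a summand
  is of order \<open>4 ^ (-k)\<close>, while the count grows only like \<open>2 ^ k\<close>. The
  resulting series is geometric with ratio 1/2; the 8 is a factor 4 for the width of a layer times
  the sum 2 of the series.\<close>

lemma sum_decay_le_of_card_le:
  fixes s :: "'a \<Rightarrow> real"
  assumes fin: "finite X" and PQ: "P \<ge> 0" "Q \<ge> 0"
    and count: "\<And>t. t \<ge> 0 \<Longrightarrow> real (card {x\<in>X. s x \<le> t}) \<le> P + Q * t"
  shows "(\<Sum>x\<in>X. if s x \<le> 1 then 1 else 1 / (s x)\<^sup>2) \<le> 8 * (P + Q)"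
proof -
  obtain K :: nat where K: "\<And>x. x \<in> X \<Longrightarrow> s x \<le> 2 ^ K"
  proof -
    obtain b where b: "\<And>x. x \<in> X \<Longrightarrow> s x \<le> b"
      using finite_imageI[OF fin, of s] bdd_above_finite[of "s ` X"] by (auto simp: bdd_above_def)
    obtain K :: nat where "b < 2 ^ K" using real_arch_pow[of 2 b] by auto
    with b show thesis by (intro that[of K]) force
  qed
  \<comment> \<open>The single term at the least \<open>k\<close> with
    \<open>s x \<le> 2 ^ k\<close> already dominates the left-hand side; the other terms are
    nonnegative.\<close>
  have pt: "(if s x \<le> 1 then 1 else 1 / (s x)\<^sup>2) \<le> (\<Sum>k\<le>K. 4 * (1/4) ^ k * (if s x \<le> 2 ^ k then 1 else 0))"
    (is "_ \<le> sum ?g _") if x: "x \<in> X" for x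
  proof -
    define k where "k = (LEAST k. s x \<le> 2 ^ k)"
    have k: "s x \<le> 2 ^ k" "k \<le> K"
      unfolding k_def using K[OF x] by (auto intro: LeastI Least_le)
    have "(if s x \<le> 1 then 1 else 1 / (s x)\<^sup>2) \<le> 4 * (1/4) ^ k"
    proof (cases k)
      case 0
      then show ?thesis using k by auto
    next
      case (Suc j)
      then have "s x > 2 ^ j" using not_less_Least[of j "\<lambda>k. s x \<le> 2 ^ k"] by (simp add: k_def)
      moreover then have "(s x)\<^sup>2 \<ge> (2 ^ j)\<^sup>2" by (intro power_mono) auto
      then have "1 / (s x)\<^sup>2 \<le> 1 / (2 ^ j)\<^sup>2" using \<open>s x > 2 ^ j\<close> zero_less_power[of "2::real" j] by (intro divide_left_mono) (auto simp del: zero_less_power)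
      moreover have "1 / ((2::real) ^ j)\<^sup>2 = (1/4) ^ j"
        by (simp add: power_divide power2_eq_square flip: power_mult_distrib)
      moreover have "(2::real) ^ j \<ge> 1" by simp
      ultimately have "\<not> s x \<le> 1" "1 / (s x)\<^sup>2 \<le> (1/4) ^ j" by linarith+
      then show ?thesis using Suc by simp
    qed
    also have "\<dots> = ?g k" using k by simp
    also have "\<dots> \<le> sum ?g {..K}" using k by (intro member_le_sum) auto
    finally show ?thesis .
  qed
  have "(\<Sum>x\<in>X. if s x \<le> 1 then 1 else 1 / (s x)\<^sup>2)
      \<le> (\<Sum>x\<in>X. \<Sum>k\<le>K. 4 * (1/4) ^ k * (if s x \<le> 2 ^ k then 1 else 0))"
    by (intro sum_mono pt)
  also have "\<dots> = (\<Sum>k\<le>K. 4 * (1/4) ^ k * real (card {x\<in>X. s x \<le> 2 ^ k}))"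
    by (subst sum.swap) (simp add: sum_distrib_left[symmetric] sum.If_cases fin Int_def)
  also have "\<dots> \<le> (\<Sum>k\<le>K. 4 * (1/4) ^ k * (P + Q * 2 ^ k))"
    by (intro sum_mono mult_left_mono count) auto
  also have "\<dots> \<le> (\<Sum>k\<le>K. 4 * (1/2) ^ k * (P + Q))"
  proof (rule sum_mono)
    fix k :: nat
    have "P * (1/4) ^ k \<le> P * (1/2) ^ k" using PQ by (intro mult_left_mono power_mono) auto
    moreover have "(1/4) ^ k * 2 ^ k = ((1/2) ^ k :: real)" by (simp flip: power_mult_distrib)
    ultimately show "4 * (1/4) ^ k * (P + Q * 2 ^ k) \<le> 4 * (1/2) ^ k * (P + Q)"
      by (simp add: algebra_simps)
  qed
  also have "\<dots> = 4 * (P + Q) * (\<Sum>k\<le>K. (1/2) ^ k)" by (simp only: sum_distrib_left mult_ac)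
  also have "\<dots> \<le> 4 * (P + Q) * 2"
  proof -
    have "(\<Sum>k\<le>K. (1/2::real) ^ k) \<le> (\<Sum>k. (1/2) ^ k)" by (intro sum_le_suminf) (auto intro: summable_geometric)
    then show ?thesis using PQ by (intro mult_left_mono) (auto simp: suminf_geometric)
  qed
  finally show ?thesis by simp
qed

text \<open>With \<open>R = norm \<xi>\<close> and \<kappa> = min 1 (R * d), each summand is at most
  \<open>16 * \<kappa>^2\<close> times the minimum of 1 and \<open>1 / s^2\<close>. The condition
  \<open>s u \<le> t\<close> confines \<open>u\<close> to a strip of half-width
  \<open>t / R + 2 * d\<close>, so the count is linear in \<open>t\<close> with coefficients
  \<open>4200 / d\<close> and \<open>1400 / (R * d^2)\<close>. The bound \<kappa> \<le> 1 absorbs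
  the first coefficient, \<kappa> \<le> R * d the second.\<close>

lemma sum_segment_mult_diff_le:
  fixes D :: "(real^3) set" and \<pi> :: "real^3 \<Rightarrow> real^3"
  assumes fin: "finite D" and D: "D \<subseteq> sphere 0 1" "separated d D" and d: "0 < d" "d \<le> 2"
    and near: "\<And>u. u \<in> D \<Longrightarrow> norm (u - \<pi> u) \<le> 2 * d"
  shows "(\<Sum>u\<in>D. (cmod (segment_mult (\<xi> \<bullet> u) - segment_mult (\<xi> \<bullet> \<pi> u)))\<^sup>2) \<le> 1000000 / d"
proof (cases "\<xi> = 0")
  case True
  then show ?thesis using d by simp
next
  case False
  define R where "R = norm \<xi>"
  have R: "R > 0" using False by (simp add: R_def)
  define \<kappa> where "\<kappa> = min 1 (R * d)"
  have \<kappa>: "0 < \<kappa>" "\<kappa> \<le> 1" "\<kappa> \<le> R * d" using R d by (auto simp: \<kappa>_def)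
  \<comment> \<open>The minimum is taken so that both multipliers, at \<open>u\<close> and at
    \<open>\<pi> u\<close>, decay like \<open>1 / s\<close>. The price is small: the two inner
    products differ by at most \<open>2 * R * d\<close>, which merely widens the strip by
    \<open>2 * d\<close>.\<close>
  define s where "s = (\<lambda>u. min \<bar>\<xi> \<bullet> u\<bar> \<bar>\<xi> \<bullet> \<pi> u\<bar>)"
  have ab: "\<bar>\<xi> \<bullet> u - \<xi> \<bullet> \<pi> u\<bar> \<le> 2 * (R * d)" if "u \<in> D" for u
  proof -
    have "\<bar>\<xi> \<bullet> (u - \<pi> u)\<bar> \<le> R * norm (u - \<pi> u)" unfolding R_def by (rule Cauchy_Schwarz_ineq2)
    also have "\<dots> \<le> R * (2 * d)" using near[OF that] R by (intro mult_left_mono) auto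
    finally show ?thesis by (simp add: inner_diff_right mult_ac)
  qed
  have pt: "(cmod (segment_mult (\<xi> \<bullet> u) - segment_mult (\<xi> \<bullet> \<pi> u)))\<^sup>2 \<le> 16 * \<kappa>\<^sup>2 * (if s u \<le> 1 then 1 else 1 / (s u)\<^sup>2)"
    if u: "u \<in> D" for u
  proof -
    let ?a = "\<xi> \<bullet> u" and ?b = "\<xi> \<bullet> \<pi> u"
    let ?\<delta> = "cmod (segment_mult ?a - segment_mult ?b)"
    have "?\<delta> \<le> 2" using norm_triangle_ineq4[of "segment_mult ?a" "segment_mult ?b"]
        norm_segment_mult_le_1[of ?a] norm_segment_mult_le_1[of ?b] by linarith
    moreover have "?\<delta> \<le> 2 * (R * d)" using norm_segment_mult_diff_le[of ?a ?b] ab[OF u] by linarith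
    moreover have "R * d > 0" using R d by simp
    ultimately have 1: "?\<delta> \<le> 4 * \<kappa>" by (auto simp: \<kappa>_def min_def)
    have s0: "s u \<ge> 0" by (simp add: s_def)
    have "s u * ?\<delta> \<le> \<bar>?a\<bar> * ?\<delta>" by (intro mult_right_mono) (auto simp: s_def)
    also have "\<dots> \<le> 2 * \<bar>?a - ?b\<bar>" by (rule norm_segment_mult_diff_le_divide)
    also have "\<dots> \<le> 2 * (2 * (R * d))" using ab[OF u] by (intro mult_left_mono) auto
    finally have 2: "s u * ?\<delta> \<le> 4 * (R * d)" by simp
    have "s u * ?\<delta> \<le> s u * (cmod (segment_mult ?a) + cmod (segment_mult ?b))"
      using s0 by (intro mult_left_mono norm_triangle_ineq4) auto
    also have "\<dots> \<le> \<bar>?a\<bar> * cmod (segment_mult ?a) + \<bar>?b\<bar> * cmod (segment_mult ?b)"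
      unfolding distrib_left by (intro add_mono mult_right_mono) (auto simp: s_def)
    also have "\<dots> \<le> 2 + 2" by (intro add_mono norm_segment_mult_le_inverse)
    finally have 3: "s u * ?\<delta> \<le> 4 * \<kappa>" using 2 by (auto simp: \<kappa>_def min_def)
    show ?thesis
    proof (cases "s u \<le> 1")
      case True
      have "?\<delta>\<^sup>2 \<le> (4 * \<kappa>)\<^sup>2" using 1 by (intro power_mono) auto
      then show ?thesis using True by (simp add: power_mult_distrib)
    next
      case False
      then have "?\<delta> \<le> 4 * \<kappa> / s u" using 3 by (simp add: field_simps)
      then have "?\<delta>\<^sup>2 \<le> (4 * \<kappa> / s u)\<^sup>2" by (intro power_mono) auto
      then show ?thesis using False by (simp add: power_mult_distrib power_divide)
    qed
  qed
  have "(\<Sum>u\<in>D. if s u \<le> 1 then 1 else 1 / (s u)\<^sup>2) \<le> 8 * (4200 / d + 1400 / (R * d\<^sup>2))"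
  proof (rule sum_decay_le_of_card_le[OF fin])
    fix t :: real assume t: "t \<ge> 0"
    let ?h = "t / R + 2 * d" and ?e = "\<xi> /\<^sub>R R"
    have "{u\<in>D. s u \<le> t} \<subseteq> {u\<in>D. \<bar>u \<bullet> ?e\<bar> \<le> ?h}"
    proof safe
      fix u assume u: "u \<in> D" "s u \<le> t"
      then have "\<bar>\<xi> \<bullet> u\<bar> \<le> t + 2 * (R * d)" using ab[of u] by (auto simp: s_def min_def split: if_splits)
      then have "\<bar>\<xi> \<bullet> u\<bar> / R \<le> ?h" using R by (simp add: field_simps)
      then show "\<bar>u \<bullet> ?e\<bar> \<le> ?h" using R by (simp add: inner_commute abs_mult divide_inverse mult.commute)
    qed
    then have "real (card {u\<in>D. s u \<le> t}) \<le> real (card {u\<in>D. \<bar>u \<bullet> ?e\<bar> \<le> ?h})"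
      using fin by (intro of_nat_mono card_mono) auto
    also have "\<dots> \<le> 1400 * (1 + ?h / d) / d"
      using t R d False by (intro card_separated_strip_le[OF fin D d]) (auto simp: R_def)
    also have "\<dots> = 4200 / d + 1400 / (R * d\<^sup>2) * t"
      using R d by (simp add: distrib_left distrib_right add_divide_distrib power2_eq_square)
    finally show "real (card {u\<in>D. s u \<le> t}) \<le> 4200 / d + 1400 / (R * d\<^sup>2) * t" .
  qed (use R d in auto)
  then have dec: "16 * \<kappa>\<^sup>2 * (\<Sum>u\<in>D. if s u \<le> 1 then 1 else 1 / (s u)\<^sup>2)
      \<le> 16 * \<kappa>\<^sup>2 * (8 * (4200 / d + 1400 / (R * d\<^sup>2)))"
    by (intro mult_left_mono) auto
  have "(\<Sum>u\<in>D. (cmod (segment_mult (\<xi> \<bullet> u) - segment_mult (\<xi> \<bullet> \<pi> u)))\<^sup>2)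
      \<le> (\<Sum>u\<in>D. 16 * \<kappa>\<^sup>2 * (if s u \<le> 1 then 1 else 1 / (s u)\<^sup>2))"
    by (intro sum_mono pt)
  also have "\<dots> = 16 * \<kappa>\<^sup>2 * (\<Sum>u\<in>D. if s u \<le> 1 then 1 else 1 / (s u)\<^sup>2)"
    by (simp only: sum_distrib_left)
  also note dec
  \<comment> \<open>One factor \<kappa> of the square is paired with \<open>1 / (R * d)\<close>, so
    that \<open>\<kappa> / (R * d) \<le> 1\<close> can be used and a single \<open>1 / d\<close>
    remains. The total is 128 * 5600 = 716800.\<close>
  also have "16 * \<kappa>\<^sup>2 * (8 * (4200 / d + 1400 / (R * d\<^sup>2))) = 128 * (4200 * \<kappa>\<^sup>2 + 1400 * (\<kappa> * (\<kappa> / (R * d)))) / d"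
    using R d by (simp add: field_simps power2_eq_square)
  also have "\<dots> \<le> 128 * (4200 * 1 + 1400 * (1 * 1)) / d"
    using \<kappa> R d by (intro divide_right_mono mult_left_mono add_mono mult_mono) (auto simp: power_le_one)
  also have "\<dots> \<le> 1000000 / d" using d by (intro divide_right_mono) auto
  finally show ?thesis .
qed

section \<open>Gaussian summation and Plancherel\<close>

lemma borel_measurable_cis [measurable]: "cis \<in> borel_measurable borel"
  by (intro borel_measurable_continuous_onI continuous_intros)

lemma borel_measurable_fst_snd [measurable]:
  "fst \<in> borel_measurable (borel :: ('a::euclidean_space \<times> 'b::euclidean_space) measure)"
  "snd \<in> borel_measurable (borel :: ('a::euclidean_space \<times> 'b::euclidean_space) measure)"
  by (intro borel_measurable_continuous_onI continuous_intros)+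

lemma lborel_prod_integral:
  fixes f :: "'a::euclidean_space \<Rightarrow> real \<Rightarrow> complex"
  assumes int: "\<And>b. b \<in> Basis \<Longrightarrow> integrable lborel (f b)"
  shows "integrable lborel (\<lambda>x. \<Prod>b\<in>Basis. f b (x \<bullet> b))"
    and "(LINT x|lborel. (\<Prod>b\<in>Basis. f b (x \<bullet> b))) = (\<Prod>b\<in>Basis. (LINT t|lborel. f b t))"
proof -
  interpret product_sigma_finite "\<lambda>b::'a. lborel :: real measure" ..
  have [measurable]: "f b \<in> borel_measurable borel" if "b \<in> Basis" for b
    using borel_measurable_integrable[OF int[OF that]] by simp
  have m: "(\<lambda>y. \<Sum>b\<in>Basis. y b *\<^sub>R b) \<in> (\<Pi>\<^sub>M b\<in>(Basis::'a set). lborel) \<rightarrow>\<^sub>M borel"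
    by measurable
  have eq: "(\<Prod>b\<in>Basis. f b ((\<Sum>c\<in>Basis. y c *\<^sub>R c) \<bullet> b)) = (\<Prod>b\<in>Basis. f b (y b))" for y
    by (intro prod.cong) auto
  have "integrable (\<Pi>\<^sub>M b\<in>Basis. lborel) (\<lambda>y. \<Prod>b\<in>Basis. f b (y b))"
    by (intro product_integrable_prod int) auto
  then show "integrable lborel (\<lambda>x. \<Prod>b\<in>Basis. f b (x \<bullet> b))"
    by (subst lborel_eq, subst integrable_distr_eq[OF m]) (simp_all only: eq, measurable)
  have "(LINT x|lborel. (\<Prod>b\<in>Basis. f b (x \<bullet> b))) = (LINT y|(\<Pi>\<^sub>M b\<in>Basis. lborel). (\<Prod>b\<in>Basis. f b (y b)))"
    by (subst lborel_eq, subst integral_distr[OF m]) (simp_all only: eq, measurable)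
  also have "\<dots> = (\<Prod>b\<in>Basis. (LINT t|lborel. f b t))"
    by (intro product_integral_prod int) auto
  finally show "(LINT x|lborel. (\<Prod>b\<in>Basis. f b (x \<bullet> b))) = (\<Prod>b\<in>Basis. (LINT t|lborel. f b t))" .
qed

text \<open>The standard normal density of the whole space, written as a product over coordinates:
  its Fourier integral then factors into one-dimensional characteristic functions, which are
  known.\<close>

definition gauss :: "'a::euclidean_space \<Rightarrow> real" where
  "gauss x = (\<Prod>b\<in>Basis. std_normal_density (x \<bullet> b))"

lemma gauss_nonneg [simp]: "gauss x \<ge> 0"
  by (simp add: gauss_def prod_nonneg)

lemma borel_measurable_gauss [measurable]: "gauss \<in> borel_measurable borel"
  unfolding gauss_def by measurable

lemma exp_norm_eq_gauss:
  "exp (- (norm x)\<^sup>2 / 2) = sqrt (2 * pi) ^ DIM('a) * gauss (x :: 'a::euclidean_space)"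
proof -
  have "gauss x = (\<Prod>b\<in>(Basis :: 'a set). 1 / sqrt (2 * pi)) * exp (\<Sum>b\<in>Basis. - (x \<bullet> b)\<^sup>2 / 2)"
    by (simp only: gauss_def std_normal_density_def prod.distrib exp_sum[OF finite_Basis])
  also have "(\<Sum>b\<in>Basis. - (x \<bullet> b)\<^sup>2 / 2) = - (norm x)\<^sup>2 / 2"
    by (subst power2_norm_eq_inner, subst euclidean_inner) (simp add: power2_eq_square sum_negf sum_divide_distrib)
  finally show ?thesis by (simp add: power_divide)
qed

lemma gauss_fourier:
  fixes z :: "'a::euclidean_space"
  shows "integrable lborel (\<lambda>x. gauss x *\<^sub>R cis (z \<bullet> x))"
    and "(LINT x|lborel. gauss x *\<^sub>R cis (z \<bullet> x)) = of_real (exp (- (norm z)\<^sup>2 / 2))"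
proof -
  let ?f = "\<lambda>(b::'a) t. std_normal_density t *\<^sub>R cis ((z \<bullet> b) * t)"
  have cis_prod: "cis (z \<bullet> x) = (\<Prod>b\<in>Basis. cis ((z \<bullet> b) * (x \<bullet> b)))" for x
    by (subst euclidean_inner) (simp add: cis_conv_exp sum_distrib_left exp_sum)
  have eq: "gauss x *\<^sub>R cis (z \<bullet> x) = (\<Prod>b\<in>Basis. ?f b (x \<bullet> b))" for x
    by (simp add: gauss_def cis_prod scaleR_conv_of_real prod.distrib)
  have int: "integrable lborel (?f b)" for b
    by (rule Bochner_Integration.integrable_bound[of _ std_normal_density]) auto
  have one: "(LINT t|lborel. ?f b t) = of_real (exp (- (z \<bullet> b)\<^sup>2 / 2))" for b
  proof -
    have "(LINT t|lborel. ?f b t) = char std_normal_distribution (z \<bullet> b)"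
      unfolding char_def by (subst integral_density) (auto simp: cis_conv_exp)
    then show ?thesis by (simp add: char_std_normal_distribution)
  qed
  show "integrable lborel (\<lambda>x. gauss x *\<^sub>R cis (z \<bullet> x))"
    unfolding eq by (intro lborel_prod_integral int)
  have "(LINT x|lborel. gauss x *\<^sub>R cis (z \<bullet> x)) = (\<Prod>b\<in>Basis. of_real (exp (- (z \<bullet> b)\<^sup>2 / 2)))"
    unfolding eq by (subst lborel_prod_integral(2)[OF int]) (simp only: one)
  also have "\<dots> = of_real (exp (\<Sum>b\<in>Basis. - (z \<bullet> b)\<^sup>2 / 2))"
    by (simp only: exp_sum[OF finite_Basis] of_real_prod)
  also have "(\<Sum>b\<in>Basis. - (z \<bullet> b)\<^sup>2 / 2) = - (norm z)\<^sup>2 / 2"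
    by (subst power2_norm_eq_inner, subst euclidean_inner) (simp add: power2_eq_square sum_negf sum_divide_distrib)
  finally show "(LINT x|lborel. gauss x *\<^sub>R cis (z \<bullet> x)) = of_real (exp (- (norm z)\<^sup>2 / 2))" .
qed

lemma integrable_gauss: "integrable lborel (gauss :: 'a::euclidean_space \<Rightarrow> real)"
  and integral_gauss: "(LINT x|lborel. gauss (x :: 'a)) = 1"
proof -
  have 1: "integrable lborel (\<lambda>x::'a. complex_of_real (gauss x))"
    using gauss_fourier(1)[of "0::'a"] by (simp add: scaleR_conv_of_real)
  then show "integrable lborel (gauss :: 'a \<Rightarrow> real)" by (simp add: complex_of_real_integrable_eq)
  have "complex_of_real (LINT x|lborel. gauss (x :: 'a)) = 1"
    using gauss_fourier(2)[of "0::'a"] by (simp add: scaleR_conv_of_real)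
  then show "(LINT x|lborel. gauss (x :: 'a)) = 1" by (simp only: of_real_eq_1_iff)
qed

lemma lborel_integral_affine:
  fixes f :: "'a::euclidean_space \<Rightarrow> 'b::{banach, second_countable_topology}"
  assumes [measurable]: "f \<in> borel_measurable borel" and c: "c \<noteq> 0"
  shows "(LINT x|lborel. f x) = \<bar>c\<bar> ^ DIM('a) *\<^sub>R (LINT x|lborel. f (t + c *\<^sub>R x))"
  by (subst lborel_affine[OF c, of t]) (simp add: integral_density integral_distr)

lemma lborel_integral_translate:
  fixes f :: "'a::euclidean_space \<Rightarrow> 'b::{banach, second_countable_topology}"
  assumes [measurable]: "f \<in> borel_measurable borel"
  shows "(LINT x|lborel. f (x + t)) = (LINT x|lborel. f x)"
  using lborel_integral_affine[of f 1 t] by (simp add: add.commute)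

lemma lborel_integrable_translate:
  fixes f :: "'a::euclidean_space \<Rightarrow> 'b::{banach, second_countable_topology}"
  assumes int: "integrable lborel f"
  shows "integrable lborel (\<lambda>x. f (x + t))"
proof -
  have [measurable]: "f \<in> borel_measurable borel" using borel_measurable_integrable[OF int] by simp
  have "integrable (distr lborel borel ((+) t)) f" using int by (simp add: lborel_distr_plus)
  then show ?thesis by (subst (asm) integrable_distr_eq) (auto simp: add.commute)
qed

lemma integrable_pair_bound:
  fixes F :: "'a::euclidean_space \<Rightarrow> 'b::euclidean_space \<Rightarrow> 'c::{banach, second_countable_topology}"
  assumes f: "integrable lborel f" and g: "integrable lborel g"
    and [measurable]: "case_prod F \<in> borel_measurable (lborel \<Otimes>\<^sub>M lborel)"
    and le: "\<And>x y. norm (F x y) \<le> f x * (g y :: real)"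
  shows "integrable (lborel \<Otimes>\<^sub>M lborel) (case_prod F)"
proof (rule Bochner_Integration.integrable_bound)
  have [measurable]: "f \<in> borel_measurable borel" "g \<in> borel_measurable borel"
    using borel_measurable_integrable[OF f] borel_measurable_integrable[OF g] by simp_all
  show "integrable (lborel \<Otimes>\<^sub>M lborel) (\<lambda>(x, y). f x * g y)"
    using f g by (intro lborel_pair.Fubini_integrable) (auto simp: abs_mult)
  show "AE p in lborel \<Otimes>\<^sub>M lborel. norm (case_prod F p) \<le> norm (case p of (x, y) \<Rightarrow> f x * g y)"
    using le by (auto intro!: order_trans[OF le])
qed simp

section \<open>Fourier transform and Gaussian-weighted Plancherel\<close>

definition fourier :: "('a::euclidean_space \<Rightarrow> real) \<Rightarrow> 'a \<Rightarrow> complex" where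
  "fourier f \<xi> = (LINT x|lborel. f x *\<^sub>R cis (- (\<xi> \<bullet> x)))"

lemma integrable_fourier:
  fixes f :: "'a::euclidean_space \<Rightarrow> real"
  assumes "integrable lborel f"
  shows "integrable lborel (\<lambda>x. f x *\<^sub>R cis (- (\<xi> \<bullet> x)))"
proof (rule Bochner_Integration.integrable_bound[OF assms])
  have [measurable]: "f \<in> borel_measurable borel"
    using borel_measurable_integrable[OF assms] by simp
  show "(\<lambda>x. f x *\<^sub>R cis (- (\<xi> \<bullet> x))) \<in> borel_measurable lborel" by measurable
qed auto

text \<open>Continuity makes the translates converge pointwise, boundedness supplies dominating
  functions and square integrability, and integrability gives an honest Fourier integral. The class
  is stable under unit averages, differences and maxima, hence under every operation applied to it
  below.\<close>

definition bcont_L1 :: "('a::euclidean_space \<Rightarrow> real) \<Rightarrow> bool" where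
  "bcont_L1 f \<longleftrightarrow> continuous_on UNIV f \<and> bounded (range f) \<and> integrable lborel f"

lemma bcont_L1D:
  assumes "bcont_L1 f"
  shows "continuous_on UNIV f" "integrable lborel f" "f \<in> borel_measurable borel"
  using assms by (auto simp: bcont_L1_def intro: borel_measurable_continuous_onI)

lemma bcont_L1_bounded:
  assumes "bcont_L1 f"
  obtains B where "B > 0" "\<And>x. \<bar>f x\<bar> \<le> B"
  using assms by (auto simp: bcont_L1_def bounded_pos)

lemma bcont_L1_integrable_power2:
  assumes "bcont_L1 f"
  shows "integrable lborel (\<lambda>x. (f x)\<^sup>2)"
proof -
  note [measurable] = bcont_L1D(3)[OF assms]
  obtain B where B: "B > 0" "\<And>x. \<bar>f x\<bar> \<le> B" using bcont_L1_bounded[OF assms] by blast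
  show ?thesis
  proof (rule Bochner_Integration.integrable_bound)
    show "integrable lborel (\<lambda>x. B * f x)" using bcont_L1D(2)[OF assms] by simp
    show "AE x in lborel. norm ((f x)\<^sup>2) \<le> norm (B * f x)"
    proof (rule AE_I2)
      fix x
      have "\<bar>f x\<bar> * \<bar>f x\<bar> \<le> B * \<bar>f x\<bar>" by (intro mult_right_mono B) auto
      then show "norm ((f x)\<^sup>2) \<le> norm (B * f x)" using B(1) by (simp add: power2_eq_square abs_mult)
    qed
  qed simp
qed

text \<open>The value is \<open>(2 * pi) powr (DIM('a) / 2)\<close>. Together with the missing
  normalisation of \<open>fourier\<close> it is a common factor on both sides of the multiplier
  inequality, so only its positivity matters.\<close>

definition gauss_mass :: "'a::euclidean_space itself \<Rightarrow> real" where
  "gauss_mass _ = (LINT z|lborel. exp (- (norm (z::'a))\<^sup>2 / 2))"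

lemma gauss_mass_pos: "gauss_mass TYPE('a::euclidean_space) > 0"
  unfolding gauss_mass_def exp_norm_eq_gauss using integral_gauss[where 'a='a] by simp

lemma integrable_exp_norm: "integrable lborel (\<lambda>z::'a::euclidean_space. exp (- (norm z)\<^sup>2 / 2))"
  unfolding exp_norm_eq_gauss using integrable_gauss[where 'a='a] by simp

lemma borel_measurable_fourier [measurable]:
  assumes [measurable]: "f \<in> borel_measurable borel"
  shows "fourier f \<in> borel_measurable borel"
  unfolding fourier_def by measurable

lemma integrable_weighted_fourier:
  fixes f :: "'a::euclidean_space \<Rightarrow> real"
  assumes f: "integrable lborel f"
  shows "integrable lborel (\<lambda>\<xi>. gauss \<xi> * (cmod (fourier f (\<xi> /\<^sub>R r)))\<^sup>2)"
proof -
  have [measurable]: "f \<in> borel_measurable borel"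
    using borel_measurable_integrable[OF f] by simp
  have le: "cmod (fourier f \<xi>) \<le> (LINT x|lborel. \<bar>f x\<bar>)" for \<xi>
    unfolding fourier_def by (rule order_trans[OF integral_norm_bound]) simp
  show ?thesis
  proof (rule Bochner_Integration.integrable_bound)
    show "integrable lborel (\<lambda>\<xi>::'a. (LINT x|lborel. \<bar>f x\<bar>)\<^sup>2 * gauss \<xi>)"
      by (intro integrable_mult_right integrable_gauss)
    show "AE \<xi> in lborel. norm (gauss \<xi> * (cmod (fourier f (\<xi> /\<^sub>R r)))\<^sup>2)
        \<le> norm ((LINT x|lborel. \<bar>f x\<bar>)\<^sup>2 * gauss \<xi>)"
      using le by (auto simp: abs_mult mult.commute intro!: mult_left_mono power_mono)
  qed measurable
qed

text \<open>The squared modulus is a double integral of \<open>h x * h y\<close> against a character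
  in \<open>y - x\<close>. The Gaussian weight makes the triple integral absolutely convergent, so
  the frequency may be integrated first, and \<open>gauss_fourier\<close> evaluates that integral.
  The pair of space variables is treated as one point of the product space, so that Fubini for two
  factors suffices.\<close>

lemma weighted_fourier_eq:
  fixes h :: "'a::euclidean_space \<Rightarrow> real"
  assumes h: "integrable lborel h" and r: "r > 0"
  shows "(LINT \<xi>|lborel. gauss \<xi> * (cmod (fourier h (\<xi> /\<^sub>R r)))\<^sup>2)
    = (LINT x|lborel. (LINT y|lborel. h x * h y * exp (- (norm ((x - y) /\<^sub>R r))\<^sup>2 / 2)))"
proof -
  have [measurable]: "h \<in> borel_measurable borel"
    using borel_measurable_integrable[OF h] by simp
  let ?H = "\<lambda>p::'a \<times> 'a. h (fst p) * h (snd p)"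
  let ?c = "\<lambda>\<xi> p. cis (\<xi> \<bullet> ((snd p - fst p) /\<^sub>R r)) :: complex"
  have H: "integrable lborel ?H"
  proof -
    have "integrable (lborel \<Otimes>\<^sub>M lborel) (\<lambda>(x, y). h x * h y)"
      by (rule integrable_pair_bound[OF integrable_abs[OF h] integrable_abs[OF h]]) (auto simp: abs_mult)
    then show ?thesis by (simp only: lborel_prod case_prod_beta')
  qed
  have Hc: "integrable lborel (\<lambda>p. ?H p *\<^sub>R ?c \<xi> p)" for \<xi> :: 'a
    by (rule Bochner_Integration.integrable_bound[OF H]) (auto simp: abs_mult)
  have sq: "complex_of_real ((cmod (fourier h (\<xi> /\<^sub>R r)))\<^sup>2) = (LINT p|lborel. ?H p *\<^sub>R ?c \<xi> p)" for \<xi>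
  proof -
    let ?z = "\<xi> /\<^sub>R r"
    have "complex_of_real ((cmod (fourier h ?z))\<^sup>2) = fourier h ?z * cnj (fourier h ?z)"
      by (rule complex_norm_square)
    also have "\<dots> = (LINT x|lborel. (h x *\<^sub>R cis (- (?z \<bullet> x))) * (LINT y|lborel. h y *\<^sub>R cis (?z \<bullet> y)))"
    proof -
      have "cnj (fourier h z) = (LINT y|lborel. h y *\<^sub>R cis (z \<bullet> y))" for z
        unfolding fourier_def by (simp add: cis_cnj flip: Bochner_Integration.integral_cnj)
      then show ?thesis by (simp only: fourier_def integral_mult_left_zero)
    qed
    also have "\<dots> = (LINT x|lborel. (LINT y|lborel. ?H (x, y) *\<^sub>R ?c \<xi> (x, y)))"
    proof (rule Bochner_Integration.integral_cong[OF refl])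
      fix x
      have "(h x *\<^sub>R cis (- (?z \<bullet> x))) * (LINT y|lborel. h y *\<^sub>R cis (?z \<bullet> y))
         = (LINT y|lborel. (h x *\<^sub>R cis (- (?z \<bullet> x))) * (h y *\<^sub>R cis (?z \<bullet> y)))"
        by (rule integral_mult_right_zero[symmetric])
      also have "\<dots> = (LINT y|lborel. ?H (x, y) *\<^sub>R ?c \<xi> (x, y))"
        by (intro Bochner_Integration.integral_cong refl) (simp add: cis_mult inner_diff_right divide_inverse algebra_simps)
      finally show "(h x *\<^sub>R cis (- (?z \<bullet> x))) * (LINT y|lborel. h y *\<^sub>R cis (?z \<bullet> y))
         = (LINT y|lborel. ?H (x, y) *\<^sub>R ?c \<xi> (x, y))" .
    qed
    also have "\<dots> = (LINT p|(lborel \<Otimes>\<^sub>M lborel). ?H p *\<^sub>R ?c \<xi> p)"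
      by (rule lborel_pair.integral_fst') (use Hc[of \<xi>] in \<open>simp add: lborel_prod\<close>)
    finally show ?thesis by (simp only: lborel_prod)
  qed
  let ?F = "\<lambda>\<xi> p. (gauss \<xi> * ?H p) *\<^sub>R ?c \<xi> p"
  have F: "integrable (lborel \<Otimes>\<^sub>M lborel) (case_prod ?F)"
    by (rule integrable_pair_bound[OF integrable_gauss integrable_norm[OF H]])
      (auto simp: abs_mult case_prod_beta')
  have "complex_of_real (LINT \<xi>|lborel. gauss \<xi> * (cmod (fourier h (\<xi> /\<^sub>R r)))\<^sup>2)
      = (LINT \<xi>|lborel. (LINT p|lborel. ?F \<xi> p))"
  proof -
    have "complex_of_real (gauss \<xi> * (cmod (fourier h (\<xi> /\<^sub>R r)))\<^sup>2) = (LINT p|lborel. ?F \<xi> p)" for \<xi>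
    proof -
      have "complex_of_real (gauss \<xi> * (cmod (fourier h (\<xi> /\<^sub>R r)))\<^sup>2)
          = gauss \<xi> *\<^sub>R (LINT p|lborel. ?H p *\<^sub>R ?c \<xi> p)"
        by (simp only: of_real_mult sq scaleR_conv_of_real)
      also have "\<dots> = (LINT p|lborel. gauss \<xi> *\<^sub>R (?H p *\<^sub>R ?c \<xi> p))"
        by (rule integral_scaleR_right[symmetric])
      finally show ?thesis by (simp only: scaleR_scaleR)
    qed
    then show ?thesis by (simp only: integral_complex_of_real[symmetric])
  qed
  also have "\<dots> = (LINT p|lborel. (LINT \<xi>|lborel. ?F \<xi> p))"
    using lborel_pair.Fubini_integral[OF F] by simp
  also have "\<dots> = (LINT p|lborel. complex_of_real (?H p * exp (- (norm ((snd p - fst p) /\<^sub>R r))\<^sup>2 / 2)))"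
  proof (rule Bochner_Integration.integral_cong[OF refl])
    fix p :: "'a \<times> 'a"
    let ?z = "(snd p - fst p) /\<^sub>R r"
    have "(LINT \<xi>|lborel. ?F \<xi> p) = (LINT \<xi>|lborel. ?H p *\<^sub>R (gauss \<xi> *\<^sub>R cis (?z \<bullet> \<xi>)))"
      by (intro Bochner_Integration.integral_cong refl) (simp add: inner_commute mult_ac)
    also have "\<dots> = ?H p *\<^sub>R (LINT \<xi>|lborel. gauss \<xi> *\<^sub>R cis (?z \<bullet> \<xi>))"
      by (rule integral_scaleR_right)
    also have "\<dots> = complex_of_real (?H p * exp (- (norm ?z)\<^sup>2 / 2))"
      unfolding gauss_fourier(2) by (simp only: scaleR_conv_of_real of_real_mult)
    finally show "(LINT \<xi>|lborel. ?F \<xi> p) = complex_of_real (?H p * exp (- (norm ?z)\<^sup>2 / 2))" .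
  qed
  also have "\<dots> = complex_of_real (LINT p|lborel. ?H p * exp (- (norm ((snd p - fst p) /\<^sub>R r))\<^sup>2 / 2))"
    by (rule integral_complex_of_real)
  finally have "(LINT \<xi>|lborel. gauss \<xi> * (cmod (fourier h (\<xi> /\<^sub>R r)))\<^sup>2)
      = (LINT p|lborel. ?H p * exp (- (norm ((snd p - fst p) /\<^sub>R r))\<^sup>2 / 2))"
    by (simp only: of_real_eq_iff)
  also have "\<dots> = (LINT p|(lborel \<Otimes>\<^sub>M lborel). ?H p * exp (- (norm ((snd p - fst p) /\<^sub>R r))\<^sup>2 / 2))"
    by (simp only: lborel_prod)
  also have "\<dots> = (LINT x|lborel. (LINT y|lborel. ?H (x, y) * exp (- (norm ((y - x) /\<^sub>R r))\<^sup>2 / 2)))"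
  proof (subst lborel_pair.integral_fst'[symmetric])
    show "integrable (lborel \<Otimes>\<^sub>M lborel) (\<lambda>p. ?H p * exp (- (norm ((snd p - fst p) /\<^sub>R r))\<^sup>2 / 2))"
      unfolding lborel_prod
      by (rule Bochner_Integration.integrable_bound[OF H]) (auto simp: abs_mult mult_left_le)
  qed simp
  finally show ?thesis by (simp add: norm_minus_commute)
qed

text \<open>The substitution \<open>y = x + r * z\<close> turns the kernel into a fixed Gaussian in
  \<open>z\<close> and moves \<open>r\<close> into a translation of \<open>h\<close>. The final
  inequality is one half of Plancherel, valid for every \<open>r\<close> without a limit.\<close>

lemma weighted_fourier_correlation:
  fixes h :: "'a::euclidean_space \<Rightarrow> real"
  assumes h: "integrable lborel h" "integrable lborel (\<lambda>x. (h x)\<^sup>2)" and r: "r > 0"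
  shows "(LINT \<xi>|lborel. gauss \<xi> * (cmod (fourier h (\<xi> /\<^sub>R r)))\<^sup>2)
      = r ^ DIM('a) * (LINT p|(lborel \<Otimes>\<^sub>M lborel). exp (- (norm (fst p))\<^sup>2 / 2) * (h (snd p) * h (snd p + r *\<^sub>R fst p)))"
    (is "_ = _ * integral\<^sup>L _ ?G")
    and "integrable (lborel \<Otimes>\<^sub>M lborel) (\<lambda>p::'a \<times> 'a. exp (- (norm (fst p))\<^sup>2 / 2) * (h (snd p) * h (snd p + r *\<^sub>R fst p)))"
    and "(LINT p|(lborel \<Otimes>\<^sub>M lborel). exp (- (norm (fst p))\<^sup>2 / 2) * (h (snd p) * h (snd p + r *\<^sub>R fst p)))
      \<le> gauss_mass TYPE('a) * (LINT x|lborel. (h x)\<^sup>2)"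
proof -
  have [measurable]: "h \<in> borel_measurable borel"
    using borel_measurable_integrable[OF h(1)] by simp
  let ?g = "\<lambda>z::'a. exp (- (norm z)\<^sup>2 / 2)"
  let ?A = "\<lambda>p::'a \<times> 'a. ?g (fst p) * (h (snd p))\<^sup>2"
  let ?B = "\<lambda>p::'a \<times> 'a. ?g (fst p) * (h (snd p + r *\<^sub>R fst p))\<^sup>2"
  note sq_translate = lborel_integrable_translate[OF h(2)]
  have tr: "(LINT x|lborel. (h (x + t))\<^sup>2) = (LINT x|lborel. (h x)\<^sup>2)" for t
    by (rule lborel_integral_translate[of "\<lambda>x. (h x)\<^sup>2"]) simp
  have A: "integrable (lborel \<Otimes>\<^sub>M lborel) ?A"
    using h(2) integrable_exp_norm[where 'a='a]
    by (intro lborel_pair.Fubini_integrable) auto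
  have B: "integrable (lborel \<Otimes>\<^sub>M lborel) ?B"
    using sq_translate integrable_exp_norm[where 'a='a]
    by (intro lborel_pair.Fubini_integrable) (auto simp: tr)
  have iA: "integral\<^sup>L (lborel \<Otimes>\<^sub>M lborel) ?A = gauss_mass TYPE('a) * (LINT x|lborel. (h x)\<^sup>2)"
    by (subst lborel_pair.integral_fst'[OF A, symmetric]) (simp add: gauss_mass_def)
  have iB: "integral\<^sup>L (lborel \<Otimes>\<^sub>M lborel) ?B = gauss_mass TYPE('a) * (LINT x|lborel. (h x)\<^sup>2)"
    by (subst lborel_pair.integral_fst'[OF B, symmetric]) (simp add: gauss_mass_def tr)
  \<comment> \<open>From \<open>2 * a * b \<le> a^2 + b^2\<close>. The integrals of
    \<open>?A\<close> and \<open>?B\<close> agree by translation invariance, so nothing is lost in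
    the constant.\<close>
  have le: "\<bar>?G p\<bar> \<le> (?A p + ?B p) / 2" for p
  proof -
    have "2 * \<bar>h (snd p)\<bar> * \<bar>h (snd p + r *\<^sub>R fst p)\<bar> \<le> (h (snd p))\<^sup>2 + (h (snd p + r *\<^sub>R fst p))\<^sup>2"
      using sum_squares_bound[of "\<bar>h (snd p)\<bar>" "\<bar>h (snd p + r *\<^sub>R fst p)\<bar>"] by simp
    then have "?g (fst p) * (2 * \<bar>h (snd p)\<bar> * \<bar>h (snd p + r *\<^sub>R fst p)\<bar>) \<le> ?g (fst p) * ((h (snd p))\<^sup>2 + (h (snd p + r *\<^sub>R fst p))\<^sup>2)"
      by (intro mult_left_mono) auto
    then show ?thesis by (simp add: abs_mult distrib_left)
  qed
  show G: "integrable (lborel \<Otimes>\<^sub>M lborel) ?G"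
  proof (rule Bochner_Integration.integrable_bound)
    show "integrable (lborel \<Otimes>\<^sub>M lborel) (\<lambda>p. (?A p + ?B p) / 2)" using A B by simp
    show "AE p in lborel \<Otimes>\<^sub>M lborel. norm (?G p) \<le> norm ((?A p + ?B p) / 2)"
      using le by (auto intro!: AE_I2 order_trans[OF le])
  qed measurable
  have "integral\<^sup>L (lborel \<Otimes>\<^sub>M lborel) ?G \<le> (LINT p|(lborel \<Otimes>\<^sub>M lborel). (?A p + ?B p) / 2)"
  proof (rule integral_mono[OF G])
    show "integrable (lborel \<Otimes>\<^sub>M lborel) (\<lambda>p. (?A p + ?B p) / 2)" using A B by simp
  qed (rule order_trans[OF abs_ge_self le])
  also have "\<dots> = gauss_mass TYPE('a) * (LINT x|lborel. (h x)\<^sup>2)"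
    by (simp only: integral_divide_zero Bochner_Integration.integral_add[OF A B] iA iB) simp
  finally show "integral\<^sup>L (lborel \<Otimes>\<^sub>M lborel) ?G \<le> gauss_mass TYPE('a) * (LINT x|lborel. (h x)\<^sup>2)" .
  have "(LINT \<xi>|lborel. gauss \<xi> * (cmod (fourier h (\<xi> /\<^sub>R r)))\<^sup>2)
      = (LINT x|lborel. (LINT y|lborel. h x * h y * ?g ((x - y) /\<^sub>R r)))"
    by (rule weighted_fourier_eq[OF h(1) r])
  also have "\<dots> = (LINT x|lborel. r ^ DIM('a) * (LINT z|lborel. ?G (z, x)))"
  proof (rule Bochner_Integration.integral_cong[OF refl])
    fix x
    have "(LINT y|lborel. h x * h y * ?g ((x - y) /\<^sub>R r))
        = r ^ DIM('a) * (LINT z|lborel. h x * h (x + r *\<^sub>R z) * ?g ((x - (x + r *\<^sub>R z)) /\<^sub>R r))"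
      using lborel_integral_affine[of "\<lambda>y. h x * h y * ?g ((x - y) /\<^sub>R r)" r x] r by simp
    then show "(LINT y|lborel. h x * h y * ?g ((x - y) /\<^sub>R r)) = r ^ DIM('a) * (LINT z|lborel. ?G (z, x))"
      using r by (simp add: mult_ac)
  qed
  also have "\<dots> = r ^ DIM('a) * (LINT x|lborel. (LINT z|lborel. ?G (z, x)))"
    by simp
  also have "(LINT x|lborel. (LINT z|lborel. ?G (z, x))) = integral\<^sup>L (lborel \<Otimes>\<^sub>M lborel) ?G"
  proof -
    have eq: "(\<lambda>(z, x). ?G (z, x)) = ?G" by (rule ext) (simp add: case_prod_beta)
    show ?thesis by (rule lborel_pair.integral_snd[of "\<lambda>z x. ?G (z, x)", unfolded eq, OF G])
  qed
  finally show "(LINT \<xi>|lborel. gauss \<xi> * (cmod (fourier h (\<xi> /\<^sub>R r)))\<^sup>2) = r ^ DIM('a) * integral\<^sup>L (lborel \<Otimes>\<^sub>M lborel) ?G" .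
qed

text \<open>Scaling the frequency by \<open>r\<close> shows the quantity to be the integral of the
  squared transform against the weight \<open>gauss (r * \<eta>)\<close>, so \<open>r\<close>
  tending to 0 removes the cut-off. On the space side the correlation of \<open>h\<close> with its
  small translates tends to the square of \<open>h\<close>, dominated through the bound of
  \<open>h\<close>.\<close>

lemma weighted_fourier_tendsto:
  fixes h :: "'a::euclidean_space \<Rightarrow> real"
  assumes h: "bcont_L1 h"
  defines "r \<equiv> \<lambda>k. 1 / real (Suc k)"
  shows "(\<lambda>k. (LINT \<xi>|lborel. gauss \<xi> * (cmod (fourier h (\<xi> /\<^sub>R r k)))\<^sup>2) / r k ^ DIM('a))
    \<longlonglongrightarrow> gauss_mass TYPE('a) * (LINT x|lborel. (h x)\<^sup>2)"
proof -
  note [measurable] = bcont_L1D(3)[OF h]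
  obtain B where B: "B > 0" "\<And>x. \<bar>h x\<bar> \<le> B" using bcont_L1_bounded[OF h] by blast
  let ?g = "\<lambda>z::'a. exp (- (norm z)\<^sup>2 / 2)"
  let ?G = "\<lambda>k p. ?g (fst p) * (h (snd p) * h (snd p + r k *\<^sub>R fst p))"
  let ?A = "\<lambda>p::'a \<times> 'a. ?g (fst p) * (h (snd p) * h (snd p))"
  have r: "r k > 0" for k by (simp add: r_def)
  have "r \<longlonglongrightarrow> 0" unfolding r_def by (rule LIMSEQ_Suc[OF lim_1_over_n])
  have eq: "(LINT \<xi>|lborel. gauss \<xi> * (cmod (fourier h (\<xi> /\<^sub>R r k)))\<^sup>2) / r k ^ DIM('a) = integral\<^sup>L (lborel \<Otimes>\<^sub>M lborel) (?G k)" for k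
    using r[of k] by (subst weighted_fourier_correlation[OF bcont_L1D(2)[OF h] bcont_L1_integrable_power2[OF h] r]) simp
  have "(\<lambda>k. integral\<^sup>L (lborel \<Otimes>\<^sub>M lborel) (?G k)) \<longlonglongrightarrow> integral\<^sup>L (lborel \<Otimes>\<^sub>M lborel) ?A"
  proof (rule integral_dominated_convergence)
    show "integrable (lborel \<Otimes>\<^sub>M lborel) (\<lambda>p::'a \<times> 'a. ?g (fst p) * (B * \<bar>h (snd p)\<bar>))"
      using integrable_exp_norm[where 'a='a] bcont_L1D(2)[OF h]
      by (intro lborel_pair.Fubini_integrable) (auto simp: abs_mult)
    show "AE p in lborel \<Otimes>\<^sub>M lborel. (\<lambda>k. ?G k p) \<longlonglongrightarrow> ?A p"
    proof (rule AE_I2)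
      fix p :: "'a \<times> 'a"
      have "(\<lambda>k. snd p + r k *\<^sub>R fst p) \<longlonglongrightarrow> snd p + 0 *\<^sub>R fst p"
        by (intro tendsto_intros \<open>r \<longlonglongrightarrow> 0\<close>)
      then have "(\<lambda>k. h (snd p + r k *\<^sub>R fst p)) \<longlonglongrightarrow> h (snd p)"
        using bcont_L1D(1)[OF h] by (auto simp: continuous_on_eq_continuous_at isCont_def intro: isCont_tendsto_compose[of _ h])
      then show "(\<lambda>k. ?G k p) \<longlonglongrightarrow> ?A p" by (intro tendsto_intros)
    qed
    show "AE p in lborel \<Otimes>\<^sub>M lborel. norm (?G k p) \<le> ?g (fst p) * (B * \<bar>h (snd p)\<bar>)" for k
    proof (rule AE_I2)
      fix p :: "'a \<times> 'a"
      have "\<bar>h (snd p)\<bar> * \<bar>h (snd p + r k *\<^sub>R fst p)\<bar> \<le> \<bar>h (snd p)\<bar> * B"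
        by (intro mult_left_mono B) auto
      then show "norm (?G k p) \<le> ?g (fst p) * (B * \<bar>h (snd p)\<bar>)"
        by (simp add: abs_mult mult.commute)
    qed
  qed measurable
  also have "integral\<^sup>L (lborel \<Otimes>\<^sub>M lborel) ?A = gauss_mass TYPE('a) * (LINT x|lborel. (h x)\<^sup>2)"
  proof (subst lborel_pair.integral_fst'[symmetric])
    show "integrable (lborel \<Otimes>\<^sub>M lborel) ?A"
      using bcont_L1_integrable_power2[OF h] integrable_exp_norm[where 'a='a]
      by (intro lborel_pair.Fubini_integrable) (auto simp: power2_eq_square)
  qed (simp add: gauss_mass_def power2_eq_square)
  finally show ?thesis by (simp only: eq)
qed

text \<open>The pointwise multiplier bound is integrated against the Gaussian weight. Then the limit
  is taken only on the side of the \<open>h u\<close>, while the side of \<open>f\<close> is bounded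
  uniformly in \<open>r\<close>. Square integrability of the transforms is thus never
  discussed.\<close>

lemma sum_integral_power2_le_of_multiplier:
  fixes f :: "'a::euclidean_space \<Rightarrow> real" and h :: "'i \<Rightarrow> 'a \<Rightarrow> real"
  assumes f: "bcont_L1 f" and U: "finite U" and h: "\<And>u. u \<in> U \<Longrightarrow> bcont_L1 (h u)"
    and mult: "\<And>u \<xi>. u \<in> U \<Longrightarrow> fourier (h u) \<xi> = M u \<xi> * fourier f \<xi>"
    and B: "\<And>\<xi>. (\<Sum>u\<in>U. (cmod (M u \<xi>))\<^sup>2) \<le> B"
  shows "(\<Sum>u\<in>U. (LINT x|lborel. (h u x)\<^sup>2)) \<le> B * (LINT x|lborel. (f x)\<^sup>2)"
proof -
  define r where "r = (\<lambda>k. 1 / real (Suc k))"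
  have r: "r k > 0" for k by (simp add: r_def)
  let ?W = "\<lambda>k h. LINT \<xi>|lborel. gauss \<xi> * (cmod (fourier h (\<xi> /\<^sub>R r k)))\<^sup>2"
  let ?T = "gauss_mass TYPE('a)"
  have "(\<lambda>k. \<Sum>u\<in>U. ?W k (h u) / r k ^ DIM('a)) \<longlonglongrightarrow> (\<Sum>u\<in>U. ?T * (LINT x|lborel. (h u x)\<^sup>2))"
    unfolding r_def by (intro tendsto_sum weighted_fourier_tendsto h)
  moreover have "(\<Sum>u\<in>U. ?W k (h u) / r k ^ DIM('a)) \<le> B * (?T * (LINT x|lborel. (f x)\<^sup>2))" for k
  proof -
    have "(\<Sum>u\<in>U. ?W k (h u)) = (LINT \<xi>|lborel. (\<Sum>u\<in>U. gauss \<xi> * (cmod (fourier (h u) (\<xi> /\<^sub>R r k)))\<^sup>2))"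
      by (rule Bochner_Integration.integral_sum[symmetric])
        (intro integrable_weighted_fourier bcont_L1D(2) h)
    also have "\<dots> \<le> (LINT \<xi>|lborel. B * (gauss \<xi> * (cmod (fourier f (\<xi> /\<^sub>R r k)))\<^sup>2))"
    proof (rule integral_mono)
      fix \<xi> :: 'a
      have "(\<Sum>u\<in>U. gauss \<xi> * (cmod (fourier (h u) (\<xi> /\<^sub>R r k)))\<^sup>2)
          = (\<Sum>u\<in>U. (cmod (M u (\<xi> /\<^sub>R r k)))\<^sup>2) * (gauss \<xi> * (cmod (fourier f (\<xi> /\<^sub>R r k)))\<^sup>2)"
        unfolding sum_distrib_right
        by (intro sum.cong refl) (simp add: mult norm_mult power_mult_distrib)
      also have "\<dots> \<le> B * (gauss \<xi> * (cmod (fourier f (\<xi> /\<^sub>R r k)))\<^sup>2)"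
        by (intro mult_right_mono B) auto
      finally show "(\<Sum>u\<in>U. gauss \<xi> * (cmod (fourier (h u) (\<xi> /\<^sub>R r k)))\<^sup>2)
          \<le> B * (gauss \<xi> * (cmod (fourier f (\<xi> /\<^sub>R r k)))\<^sup>2)" .
    qed (auto intro!: Bochner_Integration.integrable_sum integrable_weighted_fourier bcont_L1D(2)[OF f] bcont_L1D(2)[OF h])
    also have "\<dots> = B * ?W k f" by simp
    finally have "(\<Sum>u\<in>U. ?W k (h u)) / r k ^ DIM('a) \<le> B * (?W k f / r k ^ DIM('a))"
      using r[of k] by (simp add: divide_right_mono)
    also have "?W k f / r k ^ DIM('a) \<le> ?T * (LINT x|lborel. (f x)\<^sup>2)"
      using weighted_fourier_correlation(1,3)[OF bcont_L1D(2)[OF f] bcont_L1_integrable_power2[OF f] r[of k]] r[of k]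
      by simp
    \<comment> \<open>Multiplication by \<open>B\<close> preserves the inequality because
      \<open>B \<ge> 0\<close>, as seen by evaluating the hypothesis at frequency 0.\<close>
    finally show ?thesis
      using sum_nonneg[of U "\<lambda>u. (cmod (M u 0))\<^sup>2"] B[of 0] by (simp add: sum_divide_distrib mult_left_mono)
  qed
  ultimately have "(\<Sum>u\<in>U. ?T * (LINT x|lborel. (h u x)\<^sup>2)) \<le> B * (?T * (LINT x|lborel. (f x)\<^sup>2))"
    by (intro LIMSEQ_le_const2) auto
  then have "?T * (\<Sum>u\<in>U. (LINT x|lborel. (h u x)\<^sup>2)) \<le> ?T * (B * (LINT x|lborel. (f x)\<^sup>2))"
    by (simp add: sum_distrib_left mult_ac)
  then show ?thesis using gauss_mass_pos[where 'a='a] by simp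
qed

section \<open>Chaining\<close>

lemma bcont_L1_diff:
  assumes "bcont_L1 f" "bcont_L1 g"
  shows "bcont_L1 (\<lambda>x. f x - g x)"
proof -
  obtain B where B: "B > 0" "\<And>x. \<bar>f x\<bar> \<le> B" using bcont_L1_bounded[OF assms(1)] by blast
  obtain C where C: "C > 0" "\<And>x. \<bar>g x\<bar> \<le> C" using bcont_L1_bounded[OF assms(2)] by blast
  have "\<bar>f x - g x\<bar> \<le> B + C" for x using B(2)[of x] C(2)[of x] by linarith
  then have "bounded (range (\<lambda>x. f x - g x))" by (auto simp: bounded_iff)
  then show ?thesis
    using bcont_L1D[OF assms(1)] bcont_L1D[OF assms(2)] by (auto simp: bcont_L1_def intro!: continuous_intros)
qed

lemma unit_average_eq:
  fixes f :: "'a::euclidean_space \<Rightarrow> real"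
  assumes [measurable]: "f \<in> borel_measurable borel"
  shows "unit_average v f x = (LINT t|lborel. indicator {-1/2..1/2} t * f (x + t *\<^sub>R v))"
  unfolding unit_average_def set_lebesgue_integral_def by (subst integral_completion) simp_all

lemma integrable_unit_interval: "integrable lborel (indicator {-1/2..1/2} :: real \<Rightarrow> real)"
  by (rule integrable_real_indicator) auto

lemma integrable_unit_average_pair:
  fixes f :: "'a::euclidean_space \<Rightarrow> real"
  assumes f: "integrable lborel f"
  shows "integrable (lborel \<Otimes>\<^sub>M lborel) (\<lambda>(t, x). indicator {-1/2..1/2} t * f (x + t *\<^sub>R v))"
proof (rule lborel_pair.Fubini_integrable)
  have [measurable]: "f \<in> borel_measurable borel"
    using borel_measurable_integrable[OF f] by simp
  show "(\<lambda>(t, x). indicator {-1/2..1/2} t * f (x + t *\<^sub>R v)) \<in> borel_measurable (lborel \<Otimes>\<^sub>M lborel)"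
    by measurable
  have "(LINT x|lborel. \<bar>f (x + t *\<^sub>R v)\<bar>) = (LINT x|lborel. \<bar>f x\<bar>)" for t
    by (rule lborel_integral_translate[of "\<lambda>x. \<bar>f x\<bar>"]) simp
  then have "(LINT x|lborel. norm (case (t, x) of (t, x) \<Rightarrow> indicator {-1/2..1/2} t * f (x + t *\<^sub>R v)))
      = indicator {-1/2..1/2} t * (LINT x|lborel. \<bar>f x\<bar>)" for t :: real
    by (simp add: abs_mult)
  then show "integrable lborel (\<lambda>t::real. LINT x|lborel. norm (case (t, x) of (t, x) \<Rightarrow> indicator {-1/2..1/2} t * f (x + t *\<^sub>R v)))"
    using integrable_unit_interval by (simp only:) (rule integrable_mult_left)
  show "AE t in lborel. integrable lborel (\<lambda>x. case (t, x) of (t, x) \<Rightarrow> indicator {-1/2..1/2} t * f (x + t *\<^sub>R v))"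
    by (intro AE_I2) (simp add: lborel_integrable_translate[OF f])
qed

lemma bcont_L1_unit_average:
  fixes f :: "'a::euclidean_space \<Rightarrow> real"
  assumes f: "bcont_L1 f"
  shows "bcont_L1 (unit_average v f)"
proof -
  note [measurable] = bcont_L1D(3)[OF f]
  obtain B where B: "B > 0" "\<And>x. \<bar>f x\<bar> \<le> B" using bcont_L1_bounded[OF f] by blast
  let ?k = "\<lambda>x t. indicator {-1/2..1/2} t * f (x + t *\<^sub>R v)"
  have eq: "unit_average v f = (\<lambda>x. LINT t|lborel. ?k x t)"
    by (intro ext unit_average_eq) simp
  have le: "\<bar>?k x t\<bar> \<le> B * indicator {-1/2..1/2} t" for x t
    using B by (auto simp: abs_mult split: split_indicator)
  have int: "integrable lborel (\<lambda>t. B * indicator {-1/2..1/2::real} t)"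
    using integrable_unit_interval by (rule integrable_mult_right)
  have "continuous_on UNIV (\<lambda>x. LINT t|lborel. ?k x t)"
  proof (rule continuous_at_imp_continuous_on, intro ballI)
    fix x
    show "isCont (\<lambda>x. LINT t|lborel. ?k x t) x"
    proof (rule continuous_at_sequentiallyI)
      fix X assume X: "X \<longlonglongrightarrow> x"
      show "(\<lambda>n. LINT t|lborel. ?k (X n) t) \<longlonglongrightarrow> (LINT t|lborel. ?k x t)"
      proof (rule integral_dominated_convergence[OF _ _ int])
        show "AE t in lborel. (\<lambda>n. ?k (X n) t) \<longlonglongrightarrow> ?k x t"
        proof (rule AE_I2)
          fix t
          have "(\<lambda>n. X n + t *\<^sub>R v) \<longlonglongrightarrow> x + t *\<^sub>R v" by (intro tendsto_intros X)
          then have "(\<lambda>n. f (X n + t *\<^sub>R v)) \<longlonglongrightarrow> f (x + t *\<^sub>R v)"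
            using bcont_L1D(1)[OF f] by (auto simp: continuous_on_eq_continuous_at intro: isCont_tendsto_compose[of _ f])
          then show "(\<lambda>n. ?k (X n) t) \<longlonglongrightarrow> ?k x t" by (intro tendsto_intros)
        qed
        show "AE t in lborel. norm (?k (X n) t) \<le> B * indicator {-1/2..1/2} t" for n
          using le by simp
      qed measurable
    qed
  qed
  moreover have "\<bar>LINT t|lborel. ?k x t\<bar> \<le> B" for x
  proof -
    have "\<bar>LINT t|lborel. ?k x t\<bar> \<le> (LINT t|lborel. \<bar>?k x t\<bar>)" by (rule integral_abs_bound)
    also have "\<dots> \<le> (LINT t|lborel. B * indicator {-1/2..1/2::real} t)"
      using B by (intro integral_mono' int le) auto
    finally show ?thesis by simp
  qed
  moreover have "integrable lborel (\<lambda>x. LINT t|lborel. ?k x t)"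
    using lborel_pair.integrable_snd[OF integrable_unit_average_pair[OF bcont_L1D(2)[OF f]]] .
  ultimately show ?thesis by (auto simp: bcont_L1_def eq bounded_iff)
qed

text \<open>After exchanging the integrals, translation by \<open>t * v\<close> multiplies the
  transform by \<open>cis (t * (\<xi> \<bullet> v))\<close>; integrating over \<open>t\<close>
  produces \<open>segment_mult\<close>.\<close>

lemma fourier_unit_average:
  fixes f :: "'a::euclidean_space \<Rightarrow> real"
  assumes f: "bcont_L1 f"
  shows "fourier (unit_average v f) \<xi> = segment_mult (\<xi> \<bullet> v) * fourier f \<xi>"
proof -
  note [measurable] = bcont_L1D(3)[OF f]
  let ?k = "\<lambda>t x. indicator {-1/2..1/2} t * f (x + t *\<^sub>R v)"
  let ?F = "\<lambda>t x. ?k t x *\<^sub>R cis (- (\<xi> \<bullet> x))"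
  have F: "integrable (lborel \<Otimes>\<^sub>M lborel) (case_prod ?F)"
    by (rule Bochner_Integration.integrable_bound[OF integrable_unit_average_pair[OF bcont_L1D(2)[OF f], of v]])
      (auto intro!: AE_I2)
  \<comment> \<open>Moving the factor \<open>cis\<close> inside the line integral requires that
    integral to exist; Fubini gives this for almost every \<open>x\<close>.\<close>
  have "AE x in lborel. integrable lborel (\<lambda>t. ?k t x)"
    by (rule lborel_pair.AE_integrable_snd[OF integrable_unit_average_pair[OF bcont_L1D(2)[OF f]]])
  then have "fourier (unit_average v f) \<xi> = (LINT x|lborel. (LINT t|lborel. ?F t x))"
    unfolding fourier_def
    by (intro integral_cong_AE) (auto simp: unit_average_eq)
  also have "\<dots> = (LINT t|lborel. (LINT x|lborel. ?F t x))"
    by (rule lborel_pair.Fubini_integral[OF F])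
  also have "\<dots> = (LINT t|lborel. (indicator {-1/2..1/2} t *\<^sub>R cis (t * (\<xi> \<bullet> v))) * fourier f \<xi>)"
  proof (rule Bochner_Integration.integral_cong[OF refl])
    fix t :: real
    let ?g = "\<lambda>y. (f y *\<^sub>R cis (- (\<xi> \<bullet> y)))"
    have "(LINT x|lborel. ?F t x) = (LINT x|lborel. (indicator {-1/2..1/2} t *\<^sub>R cis (t * (\<xi> \<bullet> v))) * ?g (x + t *\<^sub>R v))"
      by (intro Bochner_Integration.integral_cong refl) (simp add: cis_mult inner_add_right algebra_simps)
    also have "\<dots> = (indicator {-1/2..1/2} t *\<^sub>R cis (t * (\<xi> \<bullet> v))) * (LINT x|lborel. ?g (x + t *\<^sub>R v))"
      by (rule integral_mult_right_zero)
    also have "(LINT x|lborel. ?g (x + t *\<^sub>R v)) = fourier f \<xi>"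
      unfolding fourier_def by (rule lborel_integral_translate) measurable
    finally show "(LINT x|lborel. ?F t x) = (indicator {-1/2..1/2} t *\<^sub>R cis (t * (\<xi> \<bullet> v))) * fourier f \<xi>" .
  qed
  also have "\<dots> = segment_mult (\<xi> \<bullet> v) * fourier f \<xi>"
    by (simp only: integral_mult_left_zero segment_mult_def set_lebesgue_integral_def)
  finally show ?thesis .
qed

lemma fourier_diff:
  assumes "bcont_L1 f" "bcont_L1 g"
  shows "fourier (\<lambda>x. f x - g x) \<xi> = fourier f \<xi> - fourier g \<xi>"
  unfolding fourier_def scaleR_left_diff_distrib
  by (intro Bochner_Integration.integral_diff integrable_fourier bcont_L1D(2) assms)

lemma integral_unit_average_power2_le:
  assumes f: "bcont_L1 f"
  shows "(LINT x|lborel. (unit_average v f x)\<^sup>2) \<le> (LINT x|lborel. (f x)\<^sup>2)"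
proof -
  have "(\<Sum>u\<in>{v}. (LINT x|lborel. (unit_average u f x)\<^sup>2)) \<le> 1 * (LINT x|lborel. (f x)\<^sup>2)"
    using f by (intro sum_integral_power2_le_of_multiplier[where M = "\<lambda>u \<xi>. segment_mult (\<xi> \<bullet> u)"])
      (auto simp: bcont_L1_unit_average fourier_unit_average power_le_one norm_segment_mult_le_1)
  then show ?thesis by simp
qed

lemma sum_integral_unit_average_diff_le:
  fixes D :: "(real^3) set" and \<pi> :: "real^3 \<Rightarrow> real^3"
  assumes f: "bcont_L1 f" and fin: "finite D" and D: "D \<subseteq> sphere 0 1" "separated d D" and d: "0 < d" "d \<le> 2"
    and near: "\<And>u. u \<in> D \<Longrightarrow> norm (u - \<pi> u) \<le> 2 * d"
  shows "(\<Sum>u\<in>D. (LINT x|lborel. (unit_average u f x - unit_average (\<pi> u) f x)\<^sup>2))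
      \<le> 1000000 / d * (LINT x|lborel. (f x)\<^sup>2)"
proof (rule sum_integral_power2_le_of_multiplier
    [where M = "\<lambda>u \<xi>. segment_mult (\<xi> \<bullet> u) - segment_mult (\<xi> \<bullet> \<pi> u)"])
  show "(\<Sum>u\<in>D. (cmod (segment_mult (\<xi> \<bullet> u) - segment_mult (\<xi> \<bullet> \<pi> u)))\<^sup>2) \<le> 1000000 / d" for \<xi>
    by (rule sum_segment_mult_diff_le[OF fin D d near])
qed (simp_all add: f fin bcont_L1_diff bcont_L1_unit_average fourier_diff fourier_unit_average left_diff_distrib)

section \<open>Nets and the induction over scales\<close>

lemma exists_maximal_separated:
  fixes V :: "'a::metric_space set"
  assumes "finite V"
  obtains W where "W \<subseteq> V" "separated d W" "\<And>v. v \<in> V \<Longrightarrow> v \<notin> W \<Longrightarrow> \<exists>w\<in>W. dist v w < d"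
proof -
  let ?S = "{W. W \<subseteq> V \<and> separated d W}"
  have "finite ?S" using assms by simp
  moreover have "?S \<noteq> {}" by (auto simp: separated_def intro: exI[of _ "{}"])
  ultimately have "\<exists>W\<in>?S. \<forall>X\<in>?S. W \<subseteq> X \<longrightarrow> W = X" by (rule finite_has_maximal)
  then obtain W where W: "W \<subseteq> V" "separated d W"
      and max: "\<forall>X\<in>?S. W \<subseteq> X \<longrightarrow> W = X"
    by auto
  show thesis
  proof
    fix v assume v: "v \<in> V" "v \<notin> W"
    have "\<not> separated d (insert v W)"
      using bspec[OF max, of "insert v W"] v W(1) by auto
    then show "\<exists>w\<in>W. dist v w < d"
      using W(2) unfolding separated_def by (metis dist_commute insert_iff not_le)
  qed (use W in auto)
qed

text \<open>For positive \<open>i\<close>, \<open>S i\<close> collects the squared increments of all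
  directions kept at scale \<open>4 / 2 ^ i\<close>, so one function serves every \<open>v\<close>;
  \<open>S 0\<close> is the squared average of the last direction. The induction peels off the
  finest scale: a maximal subset with twice the separation is also a net, and each direction is
  compared with a nearby point of it.\<close>

lemma unit_average_chain:
  fixes V :: "(real^3) set"
  assumes f: "bcont_L1 f"
  shows "finite V \<Longrightarrow> V \<subseteq> sphere 0 1 \<Longrightarrow> separated (4 / 2 ^ n) V \<Longrightarrow>
    \<exists>S :: nat \<Rightarrow> real^3 \<Rightarrow> real. (\<forall>i\<le>n. (\<forall>x. S i x \<ge> 0) \<and> integrable lborel (S i) \<and>
        (LINT x|lborel. S i x) \<le> 1000000 * 2 ^ i * (LINT x|lborel. (f x)\<^sup>2)) \<and>
      (\<forall>v\<in>V. \<forall>x. \<bar>unit_average v f x\<bar> \<le> (\<Sum>i\<le>n. sqrt (S i x)))"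
proof (induction n arbitrary: V)
  case 0
  \<comment> \<open>Unit vectors are at distance at most 2, so a 4-separated \<open>V\<close> has at
    most one element and a single average remains, bounded with constant 1.\<close>
  have eq: "v = w" if "v \<in> V" "w \<in> V" for v w
  proof (rule ccontr)
    assume "v \<noteq> w"
    then have "4 \<le> dist v w" using 0 that by (auto simp: separated_def)
    also have "\<dots> \<le> norm v + norm w" by (simp add: dist_norm norm_triangle_ineq4)
    also have "\<dots> = 2" using subsetD[OF 0(2) that(1)] subsetD[OF 0(2) that(2)] by simp
    finally show False by simp
  qed
  obtain u where u: "\<And>v. v \<in> V \<Longrightarrow> v = u" using eq by (metis (full_types))
  have f2: "(LINT x|lborel. (f x)\<^sup>2) \<ge> 0" by (rule Bochner_Integration.integral_nonneg) simp
  have "(LINT x|lborel. (unit_average u f x)\<^sup>2) \<le> 1000000 * (LINT x|lborel. (f x)\<^sup>2)"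
    using integral_unit_average_power2_le[OF f, of u] f2 by linarith
  then show ?case
    using bcont_L1_integrable_power2[OF bcont_L1_unit_average[OF f], of u] u
    by (intro exI[of _ "\<lambda>_ x. (unit_average u f x)\<^sup>2"]) auto
next
  case (Suc n)
  let ?d = "4 / 2 ^ Suc n :: real"
  obtain W where W: "W \<subseteq> V" "separated (4 / 2 ^ n) W" "\<And>v. v \<in> V \<Longrightarrow> v \<notin> W \<Longrightarrow> \<exists>w\<in>W. dist v w < 4 / 2 ^ n"
    using exists_maximal_separated[OF Suc.prems(1)] by metis
  have "\<exists>w\<in>W. dist v w \<le> 2 * ?d" if "v \<in> V" for v
  proof (cases "v \<in> W")
    case True
    then show ?thesis by (intro bexI[of _ v]) auto
  next
    case False
    then show ?thesis using W(3)[OF that] by (auto intro: less_imp_le)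
  qed
  then obtain \<pi> where \<pi>: "\<And>v. v \<in> V \<Longrightarrow> \<pi> v \<in> W" "\<And>v. v \<in> V \<Longrightarrow> dist v (\<pi> v) \<le> 2 * ?d"
    by metis
  obtain S where S: "\<And>i. i \<le> n \<Longrightarrow> (\<forall>x. S i x \<ge> 0) \<and> integrable lborel (S i) \<and>
        (LINT x|lborel. S i x) \<le> 1000000 * 2 ^ i * (LINT x|lborel. (f x)\<^sup>2)"
      "\<And>v x. v \<in> W \<Longrightarrow> \<bar>unit_average v f x\<bar> \<le> (\<Sum>i\<le>n. sqrt (S i x))"
    using Suc.IH[of W] W(1,2) Suc.prems(1,2) by (metis finite_subset subset_trans)
  let ?h = "\<lambda>v x. unit_average v f x - unit_average (\<pi> v) f x"
  define T where "T = (\<lambda>x. \<Sum>v\<in>V. (?h v x)\<^sup>2)"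
  have h: "bcont_L1 (?h v)" for v by (intro bcont_L1_diff bcont_L1_unit_average f)
  have T0: "T x \<ge> 0" for x by (simp add: T_def sum_nonneg)
  have intT: "integrable lborel T"
    unfolding T_def by (intro Bochner_Integration.integrable_sum bcont_L1_integrable_power2 h)
  have "(LINT x|lborel. T x) = (\<Sum>v\<in>V. (LINT x|lborel. (?h v x)\<^sup>2))"
    unfolding T_def by (intro Bochner_Integration.integral_sum bcont_L1_integrable_power2 h)
  also have "\<dots> \<le> 1000000 / ?d * (LINT x|lborel. (f x)\<^sup>2)"
  proof (rule sum_integral_unit_average_diff_le[OF f Suc.prems])
    \<comment> \<open>The first increment, from scale 2 to scale 4, is the extreme case; this is the
      source of the restriction \<open>d \<le> 2\<close> in the counting lemmas.\<close>
    show "?d \<le> 2" by (simp add: field_simps)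
    show "norm (v - \<pi> v) \<le> 2 * ?d" if "v \<in> V" for v using \<pi>(2)[OF that] by (simp add: dist_norm)
  qed simp
  also have "\<dots> \<le> 1000000 * 2 ^ Suc n * (LINT x|lborel. (f x)\<^sup>2)"
    by (intro mult_right_mono Bochner_Integration.integral_nonneg) (auto simp: field_simps)
  finally have T: "(LINT x|lborel. T x) \<le> 1000000 * 2 ^ Suc n * (LINT x|lborel. (f x)\<^sup>2)" .
  have ptw: "\<bar>unit_average v f x\<bar> \<le> (\<Sum>i\<le>n. sqrt (S i x)) + sqrt (T x)" if v: "v \<in> V" for v x
  proof -
    \<comment> \<open>The supremum over directions is replaced by the square sum, to which the
      Fourier estimate applies.\<close>
    have "(?h v x)\<^sup>2 \<le> T x"
      unfolding T_def using Suc.prems(1) v by (intro member_le_sum) auto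
    then have "\<bar>?h v x\<bar> \<le> sqrt (T x)" by (simp add: real_le_rsqrt)
    then show ?thesis using S(2)[OF \<pi>(1)[OF v], of x] by linarith
  qed
  show ?case
  proof (intro exI[of _ "S(Suc n := T)"] conjI allI impI ballI)
    fix i assume i: "i \<le> Suc n"
    show "(S(Suc n := T)) i x \<ge> 0" for x using S(1)[of i] i T0 by (auto simp: le_Suc_eq)
    show "integrable lborel ((S(Suc n := T)) i)" using S(1)[of i] i intT by (auto simp: le_Suc_eq)
    show "(LINT x|lborel. (S(Suc n := T)) i x) \<le> 1000000 * 2 ^ i * (LINT x|lborel. (f x)\<^sup>2)"
      using S(1)[of i] i T by (auto simp: le_Suc_eq)
  next
    fix v x assume "v \<in> V"
    then show "\<bar>unit_average v f x\<bar> \<le> (\<Sum>i\<le>Suc n. sqrt ((S(Suc n := T)) i x))"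
      using ptw[of v x] by simp
  qed
qed

text \<open>Cauchy-Schwarz costs the number \<open>n + 1\<close> of scales, and the bounds
  \<open>2 ^ i\<close> add up to at most \<open>2 * 2 ^ n\<close>. The extended nonnegative form
  prepares for monotone limits.\<close>

lemma nn_integral_maximal_bcont_L1_le:
  fixes V :: "(real^3) set"
  assumes f: "bcont_L1 f" and V: "finite V" "V \<subseteq> sphere 0 1" "separated (4 / 2 ^ n) V"
  shows "(\<integral>\<^sup>+x. (SUP v\<in>V. ennreal (\<bar>unit_average v f x\<bar>\<^sup>2)) \<partial>lborel)
      \<le> ennreal (2000000 * (real n + 1) * 2 ^ n) * (\<integral>\<^sup>+x. ennreal ((f x)\<^sup>2) \<partial>lborel)"
proof -
  obtain S :: "nat \<Rightarrow> real^3 \<Rightarrow> real" where S: "\<And>i x. i \<le> n \<Longrightarrow> S i x \<ge> 0" "\<And>i. i \<le> n \<Longrightarrow> integrable lborel (S i)"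
      "\<And>i. i \<le> n \<Longrightarrow> (LINT x|lborel. S i x) \<le> 1000000 * 2 ^ i * (LINT x|lborel. (f x)\<^sup>2)"
      "\<And>v x. v \<in> V \<Longrightarrow> \<bar>unit_average v f x\<bar> \<le> (\<Sum>i\<le>n. sqrt (S i x))"
    using unit_average_chain[OF f V] by metis
  have f2: "(LINT x|lborel. (f x)\<^sup>2) \<ge> 0" by (rule Bochner_Integration.integral_nonneg) simp
  have S0: "(\<Sum>i\<le>n. S i x) \<ge> 0" for x by (intro sum_nonneg S) auto
  have intS: "integrable lborel (\<lambda>x. \<Sum>i\<le>n. S i x)" by (intro Bochner_Integration.integrable_sum S) auto
  have "\<bar>unit_average v f x\<bar>\<^sup>2 \<le> (real n + 1) * (\<Sum>i\<le>n. S i x)" if "v \<in> V" for v x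
  proof -
    have "\<bar>unit_average v f x\<bar>\<^sup>2 \<le> (\<Sum>i\<le>n. sqrt (S i x))\<^sup>2"
      by (intro power_mono S(4)[OF that]) auto
    also have "\<dots> \<le> (\<Sum>i\<le>n. (sqrt (S i x))\<^sup>2) * (\<Sum>i\<le>n. 1\<^sup>2)"
      using Cauchy_Schwarz_ineq_sum[of "\<lambda>i. sqrt (S i x)" "\<lambda>_. 1" "{..n}"] by simp
    also have "\<dots> = (real n + 1) * (\<Sum>i\<le>n. S i x)" using S(1) by simp
    finally show ?thesis .
  qed
  then have "(\<integral>\<^sup>+x. (SUP v\<in>V. ennreal (\<bar>unit_average v f x\<bar>\<^sup>2)) \<partial>lborel)
      \<le> (\<integral>\<^sup>+x. ennreal ((real n + 1) * (\<Sum>i\<le>n. S i x)) \<partial>lborel)"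
    by (intro nn_integral_mono SUP_least ennreal_leI) auto
  also have "\<dots> = ennreal (LINT x|lborel. (real n + 1) * (\<Sum>i\<le>n. S i x))"
    using S0 intS by (intro nn_integral_eq_integral) auto
  also have "(LINT x|lborel. (real n + 1) * (\<Sum>i\<le>n. S i x)) = (real n + 1) * (\<Sum>i\<le>n. (LINT x|lborel. S i x))"
    using S(2) by (subst integral_mult_right_zero, subst Bochner_Integration.integral_sum) auto
  also have "ennreal \<dots> \<le> ennreal (2000000 * (real n + 1) * 2 ^ n * (LINT x|lborel. (f x)\<^sup>2))"
  proof (rule ennreal_leI)
    have geo: "(\<Sum>i\<le>n. 2 ^ i) \<le> (2 * 2 ^ n :: real)" by (induction n) auto
    have "(\<Sum>i\<le>n. (LINT x|lborel. S i x)) \<le> (\<Sum>i\<le>n. 1000000 * 2 ^ i * (LINT x|lborel. (f x)\<^sup>2))"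
      by (intro sum_mono S(3)) auto
    also have "\<dots> = 1000000 * (\<Sum>i\<le>n. 2 ^ i) * (LINT x|lborel. (f x)\<^sup>2)"
      by (simp add: sum_distrib_left sum_distrib_right)
    also have "\<dots> \<le> 1000000 * (2 * 2 ^ n) * (LINT x|lborel. (f x)\<^sup>2)"
      by (intro mult_right_mono mult_left_mono geo f2) auto
    finally have "(real n + 1) * (\<Sum>i\<le>n. (LINT x|lborel. S i x)) \<le> (real n + 1) * (1000000 * (2 * 2 ^ n) * (LINT x|lborel. (f x)\<^sup>2))"
      by (rule mult_left_mono) simp
    also have "\<dots> = 2000000 * (real n + 1) * 2 ^ n * (LINT x|lborel. (f x)\<^sup>2)" by simp
    finally show "(real n + 1) * (\<Sum>i\<le>n. (LINT x|lborel. S i x)) \<le> 2000000 * (real n + 1) * 2 ^ n * (LINT x|lborel. (f x)\<^sup>2)" .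
  qed
  also have "\<dots> = ennreal (2000000 * (real n + 1) * 2 ^ n) * ennreal (LINT x|lborel. (f x)\<^sup>2)"
    using f2 by (intro ennreal_mult) auto
  also have "ennreal (LINT x|lborel. (f x)\<^sup>2) = (\<integral>\<^sup>+x. ennreal ((f x)\<^sup>2) \<partial>lborel)"
    by (rule nn_integral_eq_integral[symmetric]) (use bcont_L1_integrable_power2[OF f] in auto)
  finally show ?thesis .
qed

section \<open>Extension to square integrable functions\<close>

text \<open>With values in \<open>ennreal\<close> the average is monotone and commutes with
  increasing limits, and no integrability has to be carried along.\<close>

definition nn_average :: "'a::euclidean_space \<Rightarrow> ('a \<Rightarrow> ennreal) \<Rightarrow> 'a \<Rightarrow> ennreal" where
  "nn_average v \<phi> x = (\<integral>\<^sup>+t. indicator {-1/2..1/2} t * \<phi> (x + t *\<^sub>R v) \<partial>lborel)"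

definition nn_maximal :: "'a::euclidean_space set \<Rightarrow> ('a \<Rightarrow> ennreal) \<Rightarrow> 'a \<Rightarrow> ennreal" where
  "nn_maximal V \<phi> x = (SUP v\<in>V. (nn_average v \<phi> x)\<^sup>2)"

lemma borel_measurable_nn_average [measurable]:
  assumes [measurable]: "\<phi> \<in> borel_measurable borel"
  shows "nn_average v \<phi> \<in> borel_measurable borel"
  unfolding nn_average_def by measurable

lemma borel_measurable_nn_maximal:
  assumes [measurable]: "\<phi> \<in> borel_measurable borel" and "finite V"
  shows "nn_maximal V \<phi> \<in> borel_measurable borel"
  unfolding nn_maximal_def using assms(2)
  by (intro borel_measurable_SUP countable_finite) measurable

lemma nn_average_mono: "\<phi> \<le> \<psi> \<Longrightarrow> nn_average v \<phi> x \<le> nn_average v \<psi> x"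
  unfolding nn_average_def by (intro nn_integral_mono mult_left_mono) (auto simp: le_fun_def)

lemma nn_maximal_mono: "\<phi> \<le> \<psi> \<Longrightarrow> nn_maximal V \<phi> x \<le> nn_maximal V \<psi> x"
  unfolding nn_maximal_def by (intro SUP_mono') (simp add: nn_average_mono power_mono)

lemma nn_average_bcont_L1:
  assumes f: "bcont_L1 f" "\<And>x. f x \<ge> 0"
  shows "nn_average v (\<lambda>x. ennreal (f x)) x = ennreal \<bar>unit_average v f x\<bar>"
proof -
  note [measurable] = bcont_L1D(3)[OF f(1)]
  obtain B where B: "B > 0" "\<And>x. \<bar>f x\<bar> \<le> B" using bcont_L1_bounded[OF f(1)] by blast
  have int: "integrable lborel (\<lambda>t. indicator {-1/2..1/2} t * f (x + t *\<^sub>R v))"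
  proof (rule Bochner_Integration.integrable_bound)
    show "integrable lborel (\<lambda>t. B * indicator {-1/2..1/2::real} t)"
      using integrable_unit_interval by (rule integrable_mult_right)
    show "AE t in lborel. norm (indicator {-1/2..1/2} t * f (x + t *\<^sub>R v)) \<le> norm (B * indicator {-1/2..1/2} t)"
      using B by (auto simp: abs_mult split: split_indicator)
  qed measurable
  have "nn_average v (\<lambda>x. ennreal (f x)) x = (\<integral>\<^sup>+t. ennreal (indicator {-1/2..1/2} t * f (x + t *\<^sub>R v)) \<partial>lborel)"
    unfolding nn_average_def by (intro nn_integral_cong) (auto split: split_indicator)
  also have "\<dots> = ennreal (unit_average v f x)"
    using f int by (subst nn_integral_eq_integral) (auto simp: unit_average_eq)
  also have "unit_average v f x \<ge> 0"
    using f by (auto simp: unit_average_eq intro!: Bochner_Integration.integral_nonneg)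
  then have "ennreal (unit_average v f x) = ennreal \<bar>unit_average v f x\<bar>" by simp
  finally show ?thesis .
qed

lemma SUP_power2_ennreal:
  fixes a :: "nat \<Rightarrow> ennreal"
  assumes "incseq a"
  shows "(SUP n. a n)\<^sup>2 = (SUP n. (a n)\<^sup>2)"
proof (rule antisym)
  have "(SUP n. a n)\<^sup>2 = (SUP m. SUP n. a n * a m)"
    by (simp add: power2_eq_square SUP_mult_left_ennreal SUP_mult_right_ennreal)
  also have "\<dots> \<le> (SUP n. (a n)\<^sup>2)"
  proof (intro SUP_least)
    fix m n
    have "a n * a m \<le> (a (max n m))\<^sup>2"
      unfolding power2_eq_square using assms by (intro mult_mono) (auto simp: incseq_def)
    also have "\<dots> \<le> (SUP n. (a n)\<^sup>2)" by (intro SUP_upper) auto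
    finally show "a n * a m \<le> (SUP n. (a n)\<^sup>2)" .
  qed
  finally show "(SUP n. a n)\<^sup>2 \<le> (SUP n. (a n)\<^sup>2)" .
  show "(SUP n. (a n)\<^sup>2) \<le> (SUP n. a n)\<^sup>2"
    by (intro SUP_least power_mono SUP_upper) auto
qed

text \<open>Monotone convergence is used twice, along the segment and in space; in between, squaring
  and the supremum over \<open>V\<close> pass through the increasing limit. This carries the
  estimate from continuous functions to their increasing limits.\<close>

lemma nn_integral_nn_maximal_SUP_le:
  fixes \<phi> :: "nat \<Rightarrow> 'a::euclidean_space \<Rightarrow> ennreal"
  assumes inc: "incseq \<phi>" and [measurable]: "\<And>n. \<phi> n \<in> borel_measurable borel" and V: "finite V"
    and le: "\<And>n. (\<integral>\<^sup>+x. nn_maximal V (\<phi> n) x \<partial>lborel) \<le> c"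
  shows "(\<integral>\<^sup>+x. nn_maximal V (\<lambda>x. SUP n. \<phi> n x) x \<partial>lborel) \<le> c"
proof -
  have avg: "nn_average v (\<lambda>x. SUP n. \<phi> n x) x = (SUP n. nn_average v (\<phi> n) x)" for v x
  proof -
    have "nn_average v (\<lambda>x. SUP n. \<phi> n x) x
        = (\<integral>\<^sup>+t. (SUP n. indicator {-1/2..1/2} t * \<phi> n (x + t *\<^sub>R v)) \<partial>lborel)"
      by (simp add: nn_average_def SUP_mult_left_ennreal)
    also have "\<dots> = (SUP n. nn_average v (\<phi> n) x)"
      unfolding nn_average_def
      using inc by (intro nn_integral_monotone_convergence_SUP)
        (auto simp: incseq_def le_fun_def intro!: mult_left_mono)
    finally show ?thesis .
  qed
  have inca: "incseq (\<lambda>n. nn_average v (\<phi> n) x)" for v x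
    using inc by (auto simp: incseq_def intro!: nn_average_mono)
  have incm: "incseq (\<lambda>n. nn_maximal V (\<phi> n))"
    using inc by (auto simp: incseq_def le_fun_def[of "nn_maximal V _"] intro!: nn_maximal_mono)
  have "(\<integral>\<^sup>+x. nn_maximal V (\<lambda>x. SUP n. \<phi> n x) x \<partial>lborel)
      \<le> (\<integral>\<^sup>+x. (SUP n. nn_maximal V (\<phi> n) x) \<partial>lborel)"
  proof (intro nn_integral_mono)
    fix x
    show "nn_maximal V (\<lambda>x. SUP n. \<phi> n x) x \<le> (SUP n. nn_maximal V (\<phi> n) x)"
      unfolding nn_maximal_def avg SUP_power2_ennreal[OF inca]
    proof (intro SUP_least)
      fix v n assume "v \<in> V"
      then have "(nn_average v (\<phi> n) x)\<^sup>2 \<le> (SUP v\<in>V. (nn_average v (\<phi> n) x)\<^sup>2)"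
        by (rule SUP_upper)
      also have "\<dots> \<le> (SUP n. SUP v\<in>V. (nn_average v (\<phi> n) x)\<^sup>2)"
        by (rule SUP_upper) simp
      finally show "(nn_average v (\<phi> n) x)\<^sup>2 \<le> (SUP n. SUP v\<in>V. (nn_average v (\<phi> n) x)\<^sup>2)" .
    qed
  qed
  also have "\<dots> = (SUP n. (\<integral>\<^sup>+x. nn_maximal V (\<phi> n) x \<partial>lborel))"
    using V by (intro nn_integral_monotone_convergence_SUP incm) (auto intro: borel_measurable_nn_maximal)
  also have "\<dots> \<le> c" by (intro SUP_least le)
  finally show ?thesis .
qed

section \<open>Lower semicontinuous majorants built from bumps on open sets\<close>

lemma bcont_L1_max:
  assumes f: "bcont_L1 f" and g: "bcont_L1 g"
  shows "bcont_L1 (\<lambda>x. max (f x) (g x))"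
proof -
  obtain B where B: "\<And>x. \<bar>f x\<bar> \<le> B" using bcont_L1_bounded[OF f] by blast
  obtain C where C: "\<And>x. \<bar>g x\<bar> \<le> C" using bcont_L1_bounded[OF g] by blast
  have "\<bar>max (f x) (g x)\<bar> \<le> max B C" for x using B[of x] C[of x] by linarith
  then show ?thesis
    using bcont_L1D[OF f] bcont_L1D[OF g] by (auto simp: bcont_L1_def bounded_iff intro!: continuous_intros integrable_max)
qed

lemma bcont_L1_bump:
  fixes U :: "'a::euclidean_space set"
  assumes U: "open U" "emeasure lborel U < \<infinity>" and c: "c \<ge> 0" "m \<ge> 0"
  shows "bcont_L1 (\<lambda>x. c * min 1 (m * infdist x (- U)))" (is "bcont_L1 ?b")
    and "c * min 1 (m * infdist x (- U)) \<le> c * indicator U x"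
    and "0 \<le> c * min 1 (m * infdist x (- U))"
proof -
  have nn: "0 \<le> ?b x" for x using c by (auto simp: infdist_nonneg)
  have le: "?b x \<le> c * indicator U x" for x using c by (auto split: split_indicator simp: mult_left_le)
  have cont: "continuous_on UNIV ?b" by (intro continuous_intros)
  have "integrable lborel ?b"
  proof (rule Bochner_Integration.integrable_bound)
    show "integrable lborel (\<lambda>x. c * indicator U x)"
      using U by (intro integrable_mult_right integrable_real_indicator) auto
    show "?b \<in> borel_measurable lborel" using borel_measurable_continuous_onI[OF cont] by simp
    show "AE x in lborel. norm (?b x) \<le> norm (c * indicator U x)"
      using le nn c by (intro AE_I2) (simp add: abs_of_nonneg)
  qed
  moreover have "\<bar>?b x\<bar> \<le> c" for x
    using c nn[of x] by (simp add: abs_of_nonneg mult_left_le)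
  ultimately show "bcont_L1 ?b" using cont by (auto simp: bcont_L1_def bounded_iff)
  show "?b x \<le> c * indicator U x" "0 \<le> ?b x" by (fact le nn)+
qed

text \<open>A maximum instead of a sum: the open sets may overlap, and the square of a maximum is
  bounded by the sum of the squares without cross terms. Each bump is a truncated distance function
  of slope \<open>m\<close>, increasing to the indicator of its open set as \<open>m\<close>
  grows.\<close>

primrec bump_max :: "(nat \<Rightarrow> real) \<Rightarrow> (nat \<Rightarrow> 'a::euclidean_space set) \<Rightarrow> real \<Rightarrow> nat \<Rightarrow> 'a \<Rightarrow> real" where
  "bump_max c U m 0 = (\<lambda>x. 0)"
| "bump_max c U m (Suc n) = (\<lambda>x. max (bump_max c U m n x) (c n * min 1 (m * infdist x (- U n))))"

lemma bump_max:
  fixes U :: "nat \<Rightarrow> 'a::euclidean_space set"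
  assumes U: "\<And>j. open (U j)" "\<And>j. emeasure lborel (U j) < \<infinity>" and c: "\<And>j. c j \<ge> 0" "m \<ge> 0"
  shows "bcont_L1 (bump_max c U m n)" "0 \<le> bump_max c U m n x"
    "(bump_max c U m n x)\<^sup>2 \<le> (\<Sum>j<n. (c j)\<^sup>2 * indicator (U j) x)"
proof -
  show "bcont_L1 (bump_max c U m n)"
    using U c by (induction n) (auto intro!: bcont_L1_max bcont_L1_bump, simp add: bcont_L1_def)
  show nn: "0 \<le> bump_max c U m n x" for n by (induction n) (auto simp: le_max_iff_disj)
  show "(bump_max c U m n x)\<^sup>2 \<le> (\<Sum>j<n. (c j)\<^sup>2 * indicator (U j) x)"
  proof (induction n)
    case (Suc n)
    let ?b = "c n * min 1 (m * infdist x (- U n))"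
    have "?b\<^sup>2 \<le> (c n * indicator (U n) x)\<^sup>2"
      using bcont_L1_bump(2,3)[OF U[of n] c(1)[of n] c(2), of x] by (intro power_mono) auto
    also have "\<dots> = (c n)\<^sup>2 * indicator (U n) x" by (simp split: split_indicator)
    finally have "?b\<^sup>2 \<le> (c n)\<^sup>2 * indicator (U n) x" .
    moreover have "(\<Sum>j<n. (c j)\<^sup>2 * indicator (U j) x) \<ge> 0" "(c n)\<^sup>2 * indicator (U n) x \<ge> 0"
      by (auto intro!: sum_nonneg)
    moreover have "(max (bump_max c U m n x) ?b)\<^sup>2 \<in> {(bump_max c U m n x)\<^sup>2, ?b\<^sup>2}"
      by (simp add: max_def)
    ultimately show ?case
      unfolding sum.lessThan_Suc bump_max.simps using Suc by (elim insertE emptyE) linarith+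
  qed simp
qed

lemma bump_max_mono:
  assumes "m \<le> m'" "n \<le> n'" and c: "\<And>j. c j \<ge> 0"
  shows "bump_max c U m n x \<le> bump_max c U m' n' x"
proof -
  have "bump_max c U m n x \<le> bump_max c U m' n x"
  proof (induction n)
    case (Suc n)
    have "m * infdist x (- U n) \<le> m' * infdist x (- U n)"
      using assms(1) by (intro mult_right_mono infdist_nonneg)
    then have "c n * min 1 (m * infdist x (- U n)) \<le> c n * min 1 (m' * infdist x (- U n))"
      using c[of n] by (intro mult_left_mono) auto
    then show ?case using Suc by auto
  qed simp
  also have "\<dots> \<le> bump_max c U m' n' x"
    using assms(2) by (induction n' rule: dec_induct) auto
  finally show ?thesis .
qed

lemma bump_max_attains:
  fixes U :: "nat \<Rightarrow> 'a::euclidean_space set"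
  assumes U: "open (U j)" "emeasure lborel (U j) < \<infinity>" and c: "\<And>j. c j \<ge> 0" and x: "x \<in> U j"
  shows "\<exists>n. c j \<le> bump_max c U (real n) n x"
proof -
  \<comment> \<open>The distance to the empty set is 0 by convention, so the bump of the whole space
    would vanish; finite measure excludes this case.\<close>
  have "U j \<noteq> UNIV" using U(2) by auto
  then have "infdist x (- U j) > 0"
    using U(1) x by (intro infdist_pos_not_in_closed) auto
  then obtain k :: nat where k: "real k * infdist x (- U j) > 1"
    using ex_less_of_nat_mult by blast
  \<comment> \<open>The bound \<open>k\<close> makes the slope steep enough for the bump to reach
    its plateau at \<open>x\<close>, and \<open>Suc j\<close> ensures that bump number
    \<open>j\<close> is among the first \<open>n\<close>.\<close>
  define n where "n = max k (Suc j)"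
  have "1 \<le> real n * infdist x (- U j)"
    using k mult_right_mono[of "real k" "real n" "infdist x (- U j)"] by (simp add: n_def infdist_nonneg)
  then have "c j = c j * min 1 (real n * infdist x (- U j))" by simp
  also have "\<dots> \<le> bump_max c U (real n) (Suc j) x" by simp
  also have "\<dots> \<le> bump_max c U (real n) n x"
    by (intro bump_max_mono c) (auto simp: n_def)
  finally show ?thesis by blast
qed

lemma nn_integral_nn_maximal_bcont_L1_le:
  fixes V :: "(real^3) set"
  assumes f: "bcont_L1 f" "\<And>x. f x \<ge> 0" and V: "finite V" "V \<subseteq> sphere 0 1" "separated (4 / 2 ^ n) V"
  shows "(\<integral>\<^sup>+x. nn_maximal V (\<lambda>x. ennreal (f x)) x \<partial>lborel)
      \<le> ennreal (2000000 * (real n + 1) * 2 ^ n) * (\<integral>\<^sup>+x. ennreal ((f x)\<^sup>2) \<partial>lborel)"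
  using nn_integral_maximal_bcont_L1_le[OF f(1) V]
  by (simp add: nn_maximal_def nn_average_bcont_L1[OF f] ennreal_power)

text \<open>Each dyadic level set \<open>E j\<close>, where \<open>\<bar>F\<bar>\<close> lies
  between \<open>a j\<close> and \<open>2 * a j\<close>, is enclosed in an open set
  \<open>U j\<close> of slightly larger measure, and \<phi> takes the largest of the values
  \<open>2 * a j\<close> over the \<open>U j\<close> containing the point. The rounding of levels
  costs the factor 4 and the excess of the open sets costs \<eta>. The bound
  \<open>\<bar>F\<bar> \<le> \<phi>\<close> holds everywhere, so it can be integrated along every
  segment.\<close>

lemma exists_majorant:
  fixes F :: "real^3 \<Rightarrow> real"
  assumes F: "in_L2 F" and V: "finite V" "V \<subseteq> sphere 0 1" "separated (4 / 2 ^ n) V" and \<eta>: "\<eta> > 0"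
  obtains \<phi> where "\<phi> \<in> borel_measurable borel" "\<And>x. ennreal \<bar>F x\<bar> \<le> \<phi> x"
    "(\<integral>\<^sup>+x. nn_maximal V \<phi> x \<partial>lborel)
      \<le> ennreal (2000000 * (real n + 1) * 2 ^ n) * (4 * (\<integral>\<^sup>+x. ennreal ((F x)\<^sup>2) \<partial>lebesgue) + ennreal \<eta>)"
proof -
  have [measurable]: "F \<in> borel_measurable lebesgue" using F by (simp add: in_L2_def)
  have finF: "(\<integral>\<^sup>+x. ennreal ((F x)\<^sup>2) \<partial>lebesgue) < \<infinity>"
    using F by (auto simp: in_L2_def integrable_iff_bounded)
  \<comment> \<open>The levels run over all integer exponents; \<open>int_decode\<close> enumerates
    them by naturals, so that sums over levels are ordinary series.\<close>
  define k where "k = (\<lambda>j. real_of_int (int_decode j))"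
  define a where "a = (\<lambda>j. 2 powr k j)"
  define E where "E = (\<lambda>j. {x. F x \<noteq> 0 \<and> k j \<le> log 2 \<bar>F x\<bar> \<and> log 2 \<bar>F x\<bar> < k j + 1})"
  have a: "a j > 0" for j by (simp add: a_def)
  have E [measurable]: "E j \<in> sets lebesgue" for j
  proof -
    have "{x\<in>space lebesgue. F x \<noteq> 0 \<and> k j \<le> log 2 \<bar>F x\<bar> \<and> log 2 \<bar>F x\<bar> < k j + 1} \<in> sets lebesgue"
      unfolding log_def by measurable
    then show ?thesis by (simp add: E_def)
  qed
  have aF: "a j \<le> \<bar>F x\<bar>" "\<bar>F x\<bar> \<le> 2 * a j" if "x \<in> E j" for x j
    using that by (auto simp: E_def a_def le_log_iff log_less_iff powr_add)
  have cover: "\<exists>j. x \<in> E j" if "F x \<noteq> 0" for x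
  proof
    show "x \<in> E (int_encode \<lfloor>log 2 \<bar>F x\<bar>\<rfloor>)" using that by (simp add: E_def k_def)
  qed
  have disj: "i = j" if "x \<in> E i" "x \<in> E j" for i j x
  proof -
    have "int_decode i = int_decode j" using that unfolding E_def k_def by auto
    then show ?thesis by (metis int_decode_inverse)
  qed
  have sumE: "(\<Sum>j. ennreal ((a j)\<^sup>2) * emeasure lebesgue (E j)) \<le> (\<integral>\<^sup>+x. ennreal ((F x)\<^sup>2) \<partial>lebesgue)"
  proof -
    have "(\<Sum>j. ennreal ((a j)\<^sup>2) * emeasure lebesgue (E j)) = (\<Sum>j. (\<integral>\<^sup>+x. ennreal ((a j)\<^sup>2) * indicator (E j) x \<partial>lebesgue))"
      using E by (simp add: nn_integral_cmult_indicator)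
    also have "\<dots> = (\<integral>\<^sup>+x. (\<Sum>j. ennreal ((a j)\<^sup>2) * indicator (E j) x) \<partial>lebesgue)"
      by (intro nn_integral_suminf[symmetric]) measurable
    also have "\<dots> \<le> (\<integral>\<^sup>+x. ennreal ((F x)\<^sup>2) \<partial>lebesgue)"
    proof (intro nn_integral_mono)
      fix x
      show "(\<Sum>j. ennreal ((a j)\<^sup>2) * indicator (E j) x) \<le> ennreal ((F x)\<^sup>2)"
      proof (cases "\<exists>i. x \<in> E i")
        case True
        then obtain i where i: "x \<in> E i" by blast
        have "(\<Sum>j. ennreal ((a j)\<^sup>2) * indicator (E j) x) = (\<Sum>j\<in>{i}. ennreal ((a j)\<^sup>2) * indicator (E j) x)"
          using disj[OF i] by (intro suminf_finite) (auto simp: indicator_def)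
        also have "\<dots> = ennreal ((a i)\<^sup>2)" using i by simp
        also have "\<dots> \<le> ennreal (\<bar>F x\<bar>\<^sup>2)"
          using aF(1)[OF i] a[of i] by (intro ennreal_leI power_mono) auto
        finally show ?thesis by simp
      qed (auto simp: indicator_def)
    qed
    finally show ?thesis .
  qed
  \<comment> \<open>Chosen so that \<open>(2 * a j)^2 * e j\<close> is \<eta> / 2 ^ (j + 1), which
    sums to \<eta>.\<close>
  define e where "e = (\<lambda>j. \<eta> / (2 ^ Suc j * (2 * a j)\<^sup>2))"
  have e: "e j > 0" for j using a[of j] \<eta> by (simp add: e_def)
  have "\<exists>T. open T \<and> E j \<subseteq> T \<and> emeasure lebesgue (T - E j) < ennreal (e j)" for j
    using sets_lebesgue_outer_open[OF E e] by metis
  then obtain U where U: "\<And>j. open (U j)" "\<And>j. E j \<subseteq> U j" "\<And>j. emeasure lebesgue (U j - E j) < ennreal (e j)"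
    by metis
  have mU: "emeasure lborel (U j) \<le> emeasure lebesgue (E j) + ennreal (e j)" for j
  proof -
    have "emeasure lborel (U j) = emeasure lebesgue (E j \<union> (U j - E j))"
      using U(1,2)[of j] by (simp add: Un_absorb1)
    also have "\<dots> \<le> emeasure lebesgue (E j) + emeasure lebesgue (U j - E j)"
      using E[of j] U(1)[of j] by (intro emeasure_subadditive) auto
    also have "\<dots> \<le> emeasure lebesgue (E j) + ennreal (e j)"
      using U(3)[of j] by (intro add_left_mono) auto
    finally show ?thesis .
  qed
  have sumU: "(\<Sum>j. ennreal ((2 * a j)\<^sup>2) * emeasure lborel (U j))
      \<le> 4 * (\<integral>\<^sup>+x. ennreal ((F x)\<^sup>2) \<partial>lebesgue) + ennreal \<eta>"
  proof -
    have summand: "ennreal ((2 * a j)\<^sup>2) * emeasure lborel (U j)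
        \<le> 4 * (ennreal ((a j)\<^sup>2) * emeasure lebesgue (E j)) + ennreal (\<eta> * (1/2) ^ Suc j)" for j
    proof -
      have "ennreal ((2 * a j)\<^sup>2) * emeasure lborel (U j)
          \<le> ennreal ((2 * a j)\<^sup>2) * (emeasure lebesgue (E j) + ennreal (e j))"
        by (intro mult_left_mono mU) auto
      also have "\<dots> = ennreal ((2 * a j)\<^sup>2) * emeasure lebesgue (E j) + ennreal ((2 * a j)\<^sup>2 * e j)"
        using e[of j] by (simp add: distrib_left ennreal_mult)
      also have "(2 * a j)\<^sup>2 * e j = \<eta> * (1/2) ^ Suc j"
        using a[of j] by (simp add: e_def power_one_over field_simps)
      also have "ennreal ((2 * a j)\<^sup>2) * emeasure lebesgue (E j) = 4 * (ennreal ((a j)\<^sup>2) * emeasure lebesgue (E j))"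
        by (simp add: power_mult_distrib ennreal_mult' mult.assoc)
      finally show ?thesis .
    qed
    have geo: "(\<Sum>j. ennreal (\<eta> * (1/2) ^ Suc j)) = ennreal \<eta>"
    proof (rule suminf_ennreal_eq)
      show "(\<lambda>j. \<eta> * (1/2) ^ Suc j) sums \<eta>"
        using sums_mult[OF power_half_series, of \<eta>] by simp
    qed (use \<eta> in auto)
    have "(\<Sum>j. ennreal ((2 * a j)\<^sup>2) * emeasure lborel (U j))
        \<le> (\<Sum>j. 4 * (ennreal ((a j)\<^sup>2) * emeasure lebesgue (E j)) + ennreal (\<eta> * (1/2) ^ Suc j))"
      by (intro suminf_le summand) auto
    also have "\<dots> = 4 * (\<Sum>j. ennreal ((a j)\<^sup>2) * emeasure lebesgue (E j)) + ennreal \<eta>"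
      by (subst suminf_add[symmetric]) (simp_all only: ennreal_suminf_cmult geo summableI)
    also have "\<dots> \<le> 4 * (\<integral>\<^sup>+x. ennreal ((F x)\<^sup>2) \<partial>lebesgue) + ennreal \<eta>"
      by (intro add_right_mono mult_left_mono sumE) auto
    finally show ?thesis .
  qed
  have finU: "emeasure lborel (U j) < \<infinity>" for j
  proof (rule ccontr)
    assume "\<not> emeasure lborel (U j) < \<infinity>"
    then have top: "emeasure lborel (U j) = \<infinity>" by (simp add: less_top[symmetric])
    have "ennreal ((2 * a j)\<^sup>2) * emeasure lborel (U j) \<le> (\<Sum>j. ennreal ((2 * a j)\<^sup>2) * emeasure lborel (U j))"
      using sum_le_suminf[of "\<lambda>j. ennreal ((2 * a j)\<^sup>2) * emeasure lborel (U j)" "{j}"] by simp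
    also have "\<dots> \<le> 4 * (\<integral>\<^sup>+x. ennreal ((F x)\<^sup>2) \<partial>lebesgue) + ennreal \<eta>" by (rule sumU)
    also have "\<dots> < \<infinity>" using finF by (simp add: ennreal_mult_less_top)
    finally show False using top a[of j] by (simp add: ennreal_mult_top)
  qed
  define q where "q = (\<lambda>n x. bump_max (\<lambda>j. 2 * a j) U (real n) n x)"
  have c: "2 * a j \<ge> 0" for j using a[of j] by simp
  note bm = bump_max[where c = "\<lambda>j. 2 * a j", OF U(1) finU c of_nat_0_le_iff]
  have q: "bcont_L1 (q n)" "q n x \<ge> 0" for n x
    unfolding q_def using bm(1,2) by auto
  have [measurable]: "q n \<in> borel_measurable borel" for n by (rule bcont_L1D(3)[OF q(1)])
  let ?\<phi> = "\<lambda>n x. ennreal (q n x)"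
  have inc: "incseq ?\<phi>"
    unfolding q_def by (auto simp: incseq_def le_fun_def intro!: ennreal_leI bump_max_mono c)
  show thesis
  proof (rule that[of "\<lambda>x. SUP n. ?\<phi> n x"])
    show "(\<lambda>x. SUP n. ?\<phi> n x) \<in> borel_measurable borel" by measurable
    fix x
    show "ennreal \<bar>F x\<bar> \<le> (SUP n. ?\<phi> n x)"
    proof (cases "F x = 0")
      case False
      then obtain j where j: "x \<in> E j" using cover by blast
      then obtain n where "2 * a j \<le> q n x"
        using bump_max_attains[where c = "\<lambda>j. 2 * a j" and U = U, OF U(1) finU c subsetD[OF U(2) j]] by (auto simp: q_def)
      then have "ennreal \<bar>F x\<bar> \<le> ?\<phi> n x" using aF(2)[OF j] by (intro ennreal_leI) linarith
      also have "\<dots> \<le> (SUP n. ?\<phi> n x)" by (rule SUP_upper) simp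
      finally show ?thesis .
    qed simp
  next
    show "(\<integral>\<^sup>+x. nn_maximal V (\<lambda>x. SUP n. ?\<phi> n x) x \<partial>lborel)
      \<le> ennreal (2000000 * (real n + 1) * 2 ^ n) * (4 * (\<integral>\<^sup>+x. ennreal ((F x)\<^sup>2) \<partial>lebesgue) + ennreal \<eta>)"
    proof (rule nn_integral_nn_maximal_SUP_le[OF inc _ V(1)])
      fix i
      have "(\<integral>\<^sup>+x. ennreal ((q i x)\<^sup>2) \<partial>lborel) \<le> (\<integral>\<^sup>+x. (\<Sum>j. ennreal ((2 * a j)\<^sup>2) * indicator (U j) x) \<partial>lborel)"
      proof (intro nn_integral_mono)
        fix x
        have "ennreal ((q i x)\<^sup>2) \<le> ennreal (\<Sum>j<i. (2 * a j)\<^sup>2 * indicator (U j) x)"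
          unfolding q_def by (intro ennreal_leI bm(3))
        also have "\<dots> = (\<Sum>j<i. ennreal ((2 * a j)\<^sup>2 * indicator (U j) x))"
          by (rule sum_ennreal[symmetric]) simp
        also have "\<dots> = (\<Sum>j<i. ennreal ((2 * a j)\<^sup>2) * indicator (U j) x)"
          by (intro sum.cong refl) (simp split: split_indicator)
        also have "\<dots> \<le> (\<Sum>j. ennreal ((2 * a j)\<^sup>2) * indicator (U j) x)"
          by (intro sum_le_suminf) auto
        finally show "ennreal ((q i x)\<^sup>2) \<le> (\<Sum>j. ennreal ((2 * a j)\<^sup>2) * indicator (U j) x)" .
      qed
      also have "\<dots> = (\<Sum>j. ennreal ((2 * a j)\<^sup>2) * emeasure lborel (U j))"
        using U(1) by (subst nn_integral_suminf) (auto simp: nn_integral_cmult_indicator)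
      also note sumU
      finally have "ennreal (2000000 * (real n + 1) * 2 ^ n) * (\<integral>\<^sup>+x. ennreal ((q i x)\<^sup>2) \<partial>lborel)
          \<le> ennreal (2000000 * (real n + 1) * 2 ^ n) * (4 * (\<integral>\<^sup>+x. ennreal ((F x)\<^sup>2) \<partial>lebesgue) + ennreal \<eta>)"
        by (rule mult_left_mono) simp
      then show "(\<integral>\<^sup>+x. nn_maximal V (?\<phi> i) x \<partial>lborel)
          \<le> ennreal (2000000 * (real n + 1) * 2 ^ n) * (4 * (\<integral>\<^sup>+x. ennreal ((F x)\<^sup>2) \<partial>lebesgue) + ennreal \<eta>)"
        by (rule order_trans[OF nn_integral_nn_maximal_bcont_L1_le[OF q V]])
    qed measurable
  qed
qed

section \<open>Lebesgue measurable functions: measurability and comparison with the majorant\<close>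

lemma measurable_completion_AE_cong:
  fixes f g :: "'a \<Rightarrow> 'b::topological_space"
  assumes ae: "AE x in M. f x = g x" and g: "g \<in> borel_measurable (completion M)"
  shows "f \<in> borel_measurable (completion M)"
proof (rule measurableI)
  fix A :: "'b set" assume A: "A \<in> sets borel"
  show "f -` A \<inter> space (completion M) \<in> sets (completion M)"
  proof (rule completion.in_sets_AE)
    show "AE x in completion M. x \<in> g -` A \<inter> space (completion M) \<longleftrightarrow> x \<in> f -` A \<inter> space (completion M)"
      using AE_completion[OF ae] by eventually_elim auto
    show "g -` A \<inter> space (completion M) \<in> sets (completion M)"
      by (rule measurable_sets[OF g A])
  qed simp
qed simp

text \<open>For each \<open>t\<close> the translate of \<open>N\<close> is null; Fubini exchanges
  the two variables. A change of \<open>F\<close> on a null set therefore affects its line averages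
  only for a null set of \<open>x\<close>.\<close>

lemma AE_lborel_translate_line:
  fixes N :: "'a::euclidean_space set"
  assumes N: "N \<in> null_sets lborel"
  shows "AE x in lborel. AE t in (lborel :: real measure). x + t *\<^sub>R v \<notin> N"
proof -
  have [measurable]: "N \<in> sets borel" using N by auto
  have "(\<integral>\<^sup>+x. indicator N (x + t *\<^sub>R v) \<partial>lborel) = (0 :: ennreal)" for t
  proof -
    have "(\<integral>\<^sup>+x. indicator N (x + t *\<^sub>R v) \<partial>lborel) = (\<integral>\<^sup>+x. indicator N x \<partial>distr lborel borel ((+) (t *\<^sub>R v)))"
      by (subst nn_integral_distr) (auto simp: add.commute)
    then show ?thesis using null_setsD1[OF N] by (simp add: lborel_distr_plus)
  qed
  then have "(\<integral>\<^sup>+t. (\<integral>\<^sup>+x. indicator N (x + t *\<^sub>R v) \<partial>lborel) \<partial>(lborel :: real measure)) = (0 :: ennreal)"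
    by simp
  also have "(\<integral>\<^sup>+t. (\<integral>\<^sup>+x. indicator N (x + t *\<^sub>R v) \<partial>lborel) \<partial>(lborel :: real measure))
      = (\<integral>\<^sup>+x. (\<integral>\<^sup>+t. indicator N (x + t *\<^sub>R v) \<partial>(lborel :: real measure)) \<partial>lborel)"
    by (rule lborel_pair.Fubini') measurable
  finally have "AE x in lborel. (\<integral>\<^sup>+t. indicator N (x + t *\<^sub>R v) \<partial>(lborel :: real measure)) = (0 :: ennreal)"
    by (subst (asm) nn_integral_0_iff_AE) measurable
  then show ?thesis
  proof eventually_elim
    case (elim x)
    then have "AE t in (lborel :: real measure). indicator N (x + t *\<^sub>R v) = (0 :: ennreal)"
      by (subst (asm) nn_integral_0_iff_AE) measurable
    then show ?case by eventually_elim (auto simp: indicator_def split: if_splits)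
  qed
qed

text \<open>\<open>F\<close> is replaced by a Borel function equal to it almost everywhere. On the
  remaining null set of \<open>x\<close> the restriction of \<open>F\<close> to the line may fail to
  be measurable, but completeness makes the values there harmless.\<close>

lemma borel_measurable_unit_average:
  fixes F :: "'a::euclidean_space \<Rightarrow> real"
  assumes F: "F \<in> borel_measurable lebesgue"
  shows "unit_average v F \<in> borel_measurable lebesgue"
proof -
  obtain G where G [measurable]: "G \<in> borel_measurable borel" and FG: "AE x in lborel. F x = G x"
    using completion_ex_borel_measurable_real[OF F] by auto
  obtain N where N: "N \<in> null_sets lborel" "{x. F x \<noteq> G x} \<subseteq> N"
    using FG by (auto simp: eventually_ae_filter)
  have eq: "AE x in lborel. unit_average v F x = unit_average v G x"
    using AE_lborel_translate_line[OF N(1), of v]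
  proof eventually_elim
    case (elim x)
    let ?g = "\<lambda>H t. indicator {-1/2..1/2} t *\<^sub>R (H (x + t *\<^sub>R v) :: real)"
    have ae: "AE t in lborel. ?g F t = ?g G t"
      using elim by eventually_elim (use N(2) in auto)
    have "?g G \<in> borel_measurable lebesgue" by (intro measurable_completion) measurable
    then show ?case
      unfolding unit_average_def set_lebesgue_integral_def
      by (intro integral_cong_AE measurable_completion_AE_cong[OF ae] AE_completion ae)
  qed
  have "unit_average v G \<in> borel_measurable borel"
    unfolding unit_average_eq[OF G] by measurable
  then have "unit_average v G \<in> borel_measurable lebesgue" by (intro measurable_completion) simp
  with eq show ?thesis by (rule measurable_completion_AE_cong)
qed

text \<open>Valid for every \<open>x\<close>: where the line integral does not exist, the default
  value 0 satisfies the bound trivially.\<close>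

lemma abs_unit_average_le_nn_average:
  fixes F :: "'a::euclidean_space \<Rightarrow> real"
  assumes le: "\<And>x. ennreal \<bar>F x\<bar> \<le> \<phi> x"
  shows "ennreal \<bar>unit_average v F x\<bar> \<le> nn_average v \<phi> x"
proof -
  let ?g = "\<lambda>t. indicator {-1/2..1/2} t *\<^sub>R F (x + t *\<^sub>R v)"
  have "ennreal \<bar>unit_average v F x\<bar> \<le> (\<integral>\<^sup>+t. ennreal (norm (?g t)) \<partial>lebesgue)"
  proof (cases "integrable lebesgue ?g")
    case True
    then show ?thesis
      using integral_norm_bound_ennreal[OF True] by (simp add: unit_average_def set_lebesgue_integral_def)
  qed (simp add: unit_average_def set_lebesgue_integral_def not_integrable_integral_eq)
  \<comment> \<open>The nonnegative integral is the same for a measure and its completion even for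
    integrands not known to be measurable, such as \<open>?g\<close> here.\<close>
  also have "\<dots> = (\<integral>\<^sup>+t. ennreal (norm (?g t)) \<partial>lborel)" by (rule nn_integral_completion)
  also have "\<dots> \<le> nn_average v \<phi> x"
    unfolding nn_average_def using le by (intro nn_integral_mono) (auto split: split_indicator)
  finally show ?thesis .
qed

lemma maximal_average_bound:
  fixes F :: "real^3 \<Rightarrow> real"
  assumes F: "in_L2 F" and V: "finite V" "V \<noteq> {}" "V \<subseteq> sphere 0 1" "separated (4 / 2 ^ n) V"
  shows "in_L2 (maximal_average V F)"
    and "(norm_L2 (maximal_average V F))\<^sup>2 \<le> 8000000 * (real n + 1) * 2 ^ n * (norm_L2 F)\<^sup>2"
proof -
  have Fm: "F \<in> borel_measurable lebesgue" using F by (simp add: in_L2_def)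
  define K where "K = 2000000 * (real n + 1) * 2 ^ n"
  have K: "K > 0" by (simp add: K_def)
  have F2: "integrable lebesgue (\<lambda>x. (F x)\<^sup>2)" using F by (simp add: in_L2_def)
  define A where "A = (LINT x|lebesgue. (F x)\<^sup>2)"
  have A: "A \<ge> 0" "(\<integral>\<^sup>+x. ennreal ((F x)\<^sup>2) \<partial>lebesgue) = ennreal A"
    unfolding A_def using F2 by (simp_all add: nn_integral_eq_integral)
  have M: "maximal_average V F \<in> borel_measurable lebesgue"
    unfolding maximal_average_def[abs_def]
    using borel_measurable_unit_average[OF Fm] V(1) by (intro borel_measurable_Max borel_measurable_abs) auto
  have "(\<integral>\<^sup>+x. ennreal ((maximal_average V F x)\<^sup>2) \<partial>lebesgue) \<le> ennreal (4 * K * A)"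
  proof (rule ennreal_le_epsilon)
    fix e :: real assume e: "e > 0"
    \<comment> \<open>The excess is taken to be \<open>e / K\<close>, so that after multiplication
      by the operator bound \<open>K\<close> it contributes exactly \<open>e\<close>.\<close>
    obtain \<phi> where \<phi>: "\<phi> \<in> borel_measurable borel" "\<And>x. ennreal \<bar>F x\<bar> \<le> \<phi> x"
      "(\<integral>\<^sup>+x. nn_maximal V \<phi> x \<partial>lborel) \<le> ennreal K * (4 * ennreal A + ennreal (e / K))"
      using exists_majorant[OF F V(1,3,4), of "e / K"] e K unfolding K_def[symmetric] A(2) by auto
    have "(\<integral>\<^sup>+x. ennreal ((maximal_average V F x)\<^sup>2) \<partial>lebesgue) \<le> (\<integral>\<^sup>+x. nn_maximal V \<phi> x \<partial>lebesgue)"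
    proof (rule nn_integral_mono)
      fix x
      have "maximal_average V F x \<in> (\<lambda>v. \<bar>unit_average v F x\<bar>) ` V"
        unfolding maximal_average_def using V by (intro Max_in) auto
      then obtain v where v: "v \<in> V" "maximal_average V F x = \<bar>unit_average v F x\<bar>" by blast
      then have "ennreal ((maximal_average V F x)\<^sup>2) = (ennreal \<bar>unit_average v F x\<bar>)\<^sup>2"
        by (simp add: ennreal_power)
      also have "\<dots> \<le> (nn_average v \<phi> x)\<^sup>2"
        by (intro power_mono abs_unit_average_le_nn_average \<phi>) auto
      also have "\<dots> \<le> nn_maximal V \<phi> x" unfolding nn_maximal_def using v(1) by (rule SUP_upper)
      finally show "ennreal ((maximal_average V F x)\<^sup>2) \<le> nn_maximal V \<phi> x" .
    qed
    also have "\<dots> = (\<integral>\<^sup>+x. nn_maximal V \<phi> x \<partial>lborel)" by (rule nn_integral_completion)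
    also have "\<dots> \<le> ennreal K * (4 * ennreal A + ennreal (e / K))" by (rule \<phi>(3))
    also have "\<dots> = ennreal (K * (4 * A + e / K))"
      using A(1) K e by (simp add: ennreal_mult ennreal_plus flip: ennreal_numeral)
    also have "K * (4 * A + e / K) = 4 * K * A + e" using K by (simp add: distrib_left)
    finally show "(\<integral>\<^sup>+x. ennreal ((maximal_average V F x)\<^sup>2) \<partial>lebesgue) \<le> ennreal (4 * K * A) + ennreal e"
      using A(1) K e by simp
  qed
  then have le: "(\<integral>\<^sup>+x. ennreal ((maximal_average V F x)\<^sup>2) \<partial>lebesgue) \<le> ennreal (4 * K * A)" .
  have int: "integrable lebesgue (\<lambda>x. (maximal_average V F x)\<^sup>2)"
  proof (rule integrableI_bounded)
    show "(\<lambda>x. (maximal_average V F x)\<^sup>2) \<in> borel_measurable lebesgue" using M by measurable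
    show "(\<integral>\<^sup>+x. ennreal (norm ((maximal_average V F x)\<^sup>2)) \<partial>lebesgue) < \<infinity>"
      using le by (simp add: order_le_less_trans[OF le])
  qed
  then show "in_L2 (maximal_average V F)" using M by (simp add: in_L2_def)
  have "ennreal (LINT x|lebesgue. (maximal_average V F x)\<^sup>2) \<le> ennreal (4 * K * A)"
    using le int by (simp add: nn_integral_eq_integral)
  then have "(LINT x|lebesgue. (maximal_average V F x)\<^sup>2) \<le> 4 * K * A"
    using A(1) K by (simp add: ennreal_le_iff)
  then show "(norm_L2 (maximal_average V F))\<^sup>2 \<le> 8000000 * (real n + 1) * 2 ^ n * (norm_L2 F)\<^sup>2"
  proof -
    have "A = (norm_L2 F)\<^sup>2" using A(1) by (simp add: norm_L2_def A_def)
    then have "4 * K * A = 8000000 * (real n + 1) * 2 ^ n * (norm_L2 F)\<^sup>2" by (simp add: K_def)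
    then show ?thesis using \<open>(LINT x|lebesgue. (maximal_average V F x)\<^sup>2) \<le> 4 * K * A\<close>
      by (simp add: norm_L2_def)
  qed
qed

text \<open>\<open>n\<close> is the least exponent whose scale \<open>4 / 2 ^ n\<close> is below the
  given separation. Minimality bounds \<open>2 ^ n\<close> by twice the threshold, which is where 8
  comes from; the summand 1 covers \<open>n = 0\<close>. Taking logarithms bounds
  \<open>n\<close>.\<close>

lemma scale_count_bound:
  fixes c0 :: real and N :: nat
  assumes c0: "c0 > 0" and N: "N \<ge> 2"
  obtains n :: nat where "4 / 2 ^ n \<le> c0 * real N powr (-1/2)"
    "2 ^ n \<le> (1 + 8 / c0) * real N powr (1/2)"
    "real n + 1 \<le> (1 + (1 + \<bar>log 2 (1 + 8 / c0)\<bar>) / ln 2 + 1 / ln 2) * ln (real N)"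
proof -
  let ?b = "real N powr (1/2)"
  have b: "?b \<ge> 1" using N by (simp add: ge_one_powr_ge_zero)
  define n where "n = (LEAST n. 4 * ?b / c0 \<le> 2 ^ n)"
  have ex: "\<exists>n. 4 * ?b / c0 \<le> 2 ^ n" using real_arch_pow[of 2 "4 * ?b / c0"] by (auto intro: less_imp_le)
  have n: "4 * ?b / c0 \<le> 2 ^ n" unfolding n_def using ex by (rule LeastI_ex)
  have up: "2 ^ n \<le> (1 + 8 / c0) * ?b"
  proof (cases n)
    case 0
    have "1 * 1 \<le> (1 + 8 / c0) * ?b" using b c0 by (intro mult_mono) auto
    then show ?thesis using 0 by simp
  next
    case (Suc k)
    then have "2 ^ k < 4 * ?b / c0" using not_less_Least[of k "\<lambda>n. 4 * ?b / c0 \<le> 2 ^ n"] by (simp add: n_def not_le)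
    then have "2 ^ n \<le> 8 / c0 * ?b" using Suc by simp
    also have "\<dots> \<le> (1 + 8 / c0) * ?b" using b by (intro mult_right_mono) auto
    finally show ?thesis .
  qed
  show thesis
  proof (rule that[OF _ up])
    have "4 * ?b \<le> c0 * 2 ^ n" using n c0 by (simp add: field_simps)
    moreover have "?b > 0" using b by linarith
    ultimately have "4 / 2 ^ n \<le> c0 / ?b" by (simp add: field_simps)
    moreover have "real N powr (-1/2) = 1 / ?b"
      using powr_minus_divide[of "real N" "1/2"] by simp
    ultimately show "4 / 2 ^ n \<le> c0 * real N powr (-1/2)" by simp
    have lnN: "ln (real N) \<ge> ln 2" using N by simp
    have "real n = log 2 (2 ^ n)" by simp
    also have "\<dots> \<le> log 2 ((1 + 8 / c0) * ?b)"
      using up b c0 by (intro log_mono) (auto intro: mult_pos_pos add_pos_pos)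
    also have "\<dots> = log 2 (1 + 8 / c0) + log 2 (real N) / 2"
    proof -
      have "1 + 8 / c0 > 0" using c0 by (simp add: add_pos_pos)
      then show ?thesis using N by (subst log_mult) (auto simp: log_powr)
    qed
    finally have "real n + 1 \<le> (1 + \<bar>log 2 (1 + 8 / c0)\<bar>) * 1 + log 2 (real N) / 2"
      using abs_ge_self[of "log 2 (1 + 8 / c0)"] by simp
    \<comment> \<open>The constant term is absorbed into the logarithm because
      \<open>ln N / ln 2 \<ge> 1\<close> for \<open>N \<ge> 2\<close>.\<close>
    also have "\<dots> \<le> (1 + \<bar>log 2 (1 + 8 / c0)\<bar>) * (ln (real N) / ln 2) + ln (real N) / ln 2"
    proof (intro add_mono mult_left_mono)
      show "1 \<le> ln (real N) / ln 2" using lnN by simp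
      have "0 \<le> log 2 (real N)" using N by simp
      then have "log 2 (real N) / 2 \<le> log 2 (real N)" by simp
      then show "log 2 (real N) / 2 \<le> ln (real N) / ln 2" by (simp only: log_def)
    qed auto
    also have "\<dots> \<le> (1 + (1 + \<bar>log 2 (1 + 8 / c0)\<bar>) / ln 2 + 1 / ln 2) * ln (real N)"
    proof -
      have "ln (real N) \<ge> 0" using N by simp
      then show ?thesis by (simp add: algebra_simps add_divide_distrib)
    qed
    finally show "real n + 1 \<le> (1 + (1 + \<bar>log 2 (1 + 8 / c0)\<bar>) / ln 2 + 1 / ln 2) * ln (real N)" .
  qed
qed

theorem theorem1p2:
  fixes c0 :: real
  assumes "c0 > 0"
  shows "\<exists>C::real. \<forall>(N::nat) (V::(real^3) set).
           N \<ge> 2 \<and> finite V \<and> card V = N \<and> V \<subseteq> sphere 0 1 \<and>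
           (\<forall>v\<in>V. \<forall>v'\<in>V. v \<noteq> v' \<longrightarrow> norm (v - v') \<ge> c0 * real N powr (-1/2)) \<longrightarrow>
           (\<forall>F::real^3 \<Rightarrow> real. in_L2 F \<longrightarrow>
              in_L2 (maximal_average V F) \<and>
              norm_L2 (maximal_average V F) \<le> C * real N powr (1/4) * sqrt (ln (real N)) * norm_L2 F)"
proof -
  \<comment> \<open>\<open>a\<close> is the constant in the bound of \<open>2 ^ n\<close> by
    \<open>N powr (1/2)\<close>, \<open>b\<close> the one in the bound of the number of scales by
    \<open>ln N\<close>; both depend on \<open>c0\<close> alone. The final constant is the square
    root of their product with the 8000000 of the squared estimate.\<close>
  define a b where "a = 1 + 8 / c0" and "b = 1 + (1 + \<bar>log 2 (1 + 8 / c0)\<bar>) / ln 2 + 1 / ln 2"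
  have ab: "a \<ge> 0" "b \<ge> 0" using assms by (simp_all add: a_def b_def)
  show ?thesis
  proof (intro exI[of _ "sqrt (8000000 * a * b)"] allI impI)
    fix N :: nat and V :: "(real^3) set" and F :: "real^3 \<Rightarrow> real"
    assume H: "N \<ge> 2 \<and> finite V \<and> card V = N \<and> V \<subseteq> sphere 0 1 \<and>
           (\<forall>v\<in>V. \<forall>v'\<in>V. v \<noteq> v' \<longrightarrow> norm (v - v') \<ge> c0 * real N powr (-1/2))" and F: "in_L2 F"
    obtain n :: nat where n: "4 / 2 ^ n \<le> c0 * real N powr (-1/2)" "2 ^ n \<le> a * real N powr (1/2)"
        "real n + 1 \<le> b * ln (real N)"
      using scale_count_bound[OF assms, of N] H unfolding a_def b_def by blast
    have "separated (4 / 2 ^ n) V"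
      using H n(1) unfolding separated_def dist_norm by (meson order_trans)
    moreover have "V \<noteq> {}" using H by auto
    ultimately have M: "in_L2 (maximal_average V F)"
      "(norm_L2 (maximal_average V F))\<^sup>2 \<le> 8000000 * (real n + 1) * 2 ^ n * (norm_L2 F)\<^sup>2"
      using maximal_average_bound[OF F, of V n] H by auto
    have lnN: "ln (real N) \<ge> 0" using H by simp
    have nF: "norm_L2 F \<ge> 0" by (simp add: norm_L2_def)
    have M2: "(norm_L2 (maximal_average V F))\<^sup>2 \<le> 8000000 * ((real n + 1) * 2 ^ n) * (norm_L2 F)\<^sup>2"
      using M(2) by (simp only: mult.assoc)
    have "(real n + 1) * 2 ^ n \<le> (b * ln (real N)) * (a * real N powr (1/2))"
      using n ab lnN by (intro mult_mono) auto
    note M2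
    also have "8000000 * ((real n + 1) * 2 ^ n) * (norm_L2 F)\<^sup>2
        \<le> 8000000 * ((b * ln (real N)) * (a * real N powr (1/2))) * (norm_L2 F)\<^sup>2"
      using \<open>(real n + 1) * 2 ^ n \<le> (b * ln (real N)) * (a * real N powr (1/2))\<close>
      by (intro mult_right_mono mult_left_mono) auto
    also have "real N powr (1/2) = (real N powr (1/4))\<^sup>2"
      using H by (simp add: powr_power)
    also have "8000000 * ((b * ln (real N)) * (a * (real N powr (1/4))\<^sup>2)) * (norm_L2 F)\<^sup>2
        = (sqrt (8000000 * a * b) * real N powr (1/4) * sqrt (ln (real N)) * norm_L2 F)\<^sup>2"
      using ab lnN by (simp add: power_mult_distrib)
    finally have "(norm_L2 (maximal_average V F))\<^sup>2
        \<le> (sqrt (8000000 * a * b) * real N powr (1/4) * sqrt (ln (real N)) * norm_L2 F)\<^sup>2" .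
    then have "norm_L2 (maximal_average V F)
        \<le> sqrt (8000000 * a * b) * real N powr (1/4) * sqrt (ln (real N)) * norm_L2 F"
      by (rule power2_le_imp_le) (use ab lnN nF in \<open>auto intro!: mult_nonneg_nonneg\<close>)
    with M(1) show "in_L2 (maximal_average V F) \<and> norm_L2 (maximal_average V F)
        \<le> sqrt (8000000 * a * b) * real N powr (1/4) * sqrt (ln (real N)) * norm_L2 F" by blast
  qed
qed

end
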